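(* Let $K$ be an algebraically closed field, $1\le d\le n-1$, $X\le K^n$ a linear subspace of dimension $d+1$ with Plücker coordinates $(q_I)_{I\in\binom{[n]}{d+1}}$, and $S\subseteq[n]$ such that there is $C\in\binom{[n]}{d+1}$ with $S\subseteq C$ and $q_C\ne0$ (so that $L^S(X)$ is a linear subspace of $\mathbb{P}^{\binom{n}{d}-1}$ of projective dimension $d$). Then the Plücker coordinates $p_{J_1\ldots J_{d+1}}$ of $L^S(X)$ are given (up to one common nonzero scalar) as follows. Let $J_1,\ldots,J_{d+1}\in\binom{[n]}{d}$ be distinct and sorted in lexicographic order, and let $H$ be the hypergraph on $[n]$ with hyperedges $h_i=[n]\setminus J_i$. Then $$p_{J_1\ldots J_{d+1}}=\begin{cases}\displaystyle\sum_{\mathcal{O}}\operatorname{sign}(I_0,\mathcal{O})\prod_{i\ne i_0}q_{[n]\setminus s_{\mathcal{O}}(h_i)} & \text{if every element of } S \text{ is a leaf of } H,\\ 0&\text{otherwise.}\end{cases}$$ Here $i_0\in[d+1]$ and $I_0\subset h_{i_0}$ of size $n-d-1$ can be chosen freely, the sum runs over all orientations $\mathcal{O}$ of $H$ whose set of roots is $I_0$, and $\operatorname{sign}(I_0,\mathcal{O})=(-1)^{I_0}\varepsilon_{\mathcal{O}}$.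
   Context: $\mathrm{Gr}(d,n)\subseteq\mathbb{P}^{\binom{n}{d}-1}$ is the Grassmannian in its Plücker embedding; $\mathrm{pr}_S:K^n\to K^n$ kills $e_i$ for $i\in S$ and fixes $e_i$ for $i\notin S$; $L^S(X)=\{Y\in \mathrm{Gr}(d,n):\mathrm{pr}_S(Y)\subseteq X\}$. The Plücker coordinates of the linear space $L^S(X)$ (identified with its underlying $(d+1)$-dimensional subspace of $K^{\binom{[n]}{d}}$, coordinates ordered lexicographically) are indexed by $(d+1)$-subsets $\{J_1,\dots,J_{d+1}\}$ of $\binom{[n]}{d}$. Hypergraph notions: let $H$ be a hypergraph on vertex set $[n]$ with distinct hyperedges $h_1,\dots,h_k$ of size $n-d$, listed in reverse lexicographic order (this is the order induced by listing the complements $J_i$ lexicographically). A leaf of $H$ is a vertex contained in exactly one hyperedge. An orientation $\mathcal{O}$ of $H$ is a choice of a target $t_{\mathcal{O}}(h_i)\in h_i$ for each $i$ such that the targets of the hyperedges are pairwise distinct. The sources of $h_i$ are $s_{\mathcal{O}}(h_i)=h_i\setminus\{t_{\mathcal{O}}(h_i)\}$. The roots of $\mathcal{O}$ are $r(\mathcal{O})=\bigcup_i s_{\mathcal{O}}(h_i)\setminus\{t_{\mathcal{O}}(h_1),\dots,t_{\mathcal{O}}(h_k)\}$. The target map is $\pi_{\mathcal{O}}:[k]\to[n]\setminus r(\mathcal{O})$, $i\mapsto t_{\mathcal{O}}(h_i)$, and $\operatorname{sign}(\pi_{\mathcal{O}})=(-1)^{\#\text{inversions of }\pi_{\mathcal{O}}}$.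 The number of increasing edges of $\mathcal{O}$ is $\sum_i|s_{\mathcal{O}}(h_i)\cap[t_{\mathcal{O}}(h_i)]|$. Finally $\varepsilon_{\mathcal{O}}=(-1)^{\#\text{ increasing edges of }\mathcal{O}}\operatorname{sign}(\pi_{\mathcal{O}})$, and $(-1)^A=\prod_{a\in A}(-1)^a$ for a finite set $A$ of integers. *)

theory Defs
  imports
    "Jordan_Normal_Form.Determinant"
    "HOL-Computational_Algebra.Polynomial"
    "HOL-Library.Function_Algebras"
    "HOL-Library.Ramsey"
begin

text \<open>
  Vectors with coordinates indexed by a set \<open>A\<close> are functions vanishing outside \<open>A\<close>; the
  ambient type of all functions is a vector space with pointwise operations.
\<close>

definition fscale :: "'k::field \<Rightarrow> ('i \<Rightarrow> 'k) \<Rightarrow> 'i \<Rightarrow> 'k" where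
  "fscale c v = (\<lambda>i. c * v i)"

global_interpretation fs: vector_space fscale
  by unfold_locales (auto simp: fscale_def fun_eq_iff algebra_simps)

definition coord_space :: "'i set \<Rightarrow> ('i \<Rightarrow> 'k::field) set" where
  "coord_space A = {v. \<forall>i. i \<notin> A \<longrightarrow> v i = 0}"

definition ordered_basis :: "('i \<Rightarrow> 'k::field) set \<Rightarrow> ('i \<Rightarrow> 'k) list \<Rightarrow> bool" where
  "ordered_basis U bs \<longleftrightarrow> distinct bs \<and> fs.independent (set bs) \<and> fs.span (set bs) = U"

text \<open>
  \<open>plucker_coords lt A U p\<close>: the function \<open>p\<close> on subsets of \<open>A\<close> is a representative of the
  Pluecker coordinates of the linear subspace \<open>U\<close> of \<open>coord_space A\<close>, where \<open>lt\<close> is the strict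
  linear order on \<open>A\<close> in which the columns of the maximal minors are listed.  As the basis is
  arbitrary, \<open>p\<close> is determined by \<open>U\<close> up to a nonzero scalar.
\<close>

definition plucker_coords ::
  "('i \<Rightarrow> 'i \<Rightarrow> bool) \<Rightarrow> 'i set \<Rightarrow> ('i \<Rightarrow> 'k::field) set \<Rightarrow> ('i set \<Rightarrow> 'k) \<Rightarrow> bool" where
  "plucker_coords lt A U p \<longleftrightarrow>
     (\<exists>bs. ordered_basis U bs \<and> p \<in> coord_space (nsets A (length bs)) \<and>
        (\<forall>xs. sorted_wrt lt xs \<and> set xs \<subseteq> A \<and> length xs = length bs \<longrightarrow>
           p (set xs) = det (mat (length bs) (length bs) (\<lambda>(r, c). (bs ! r) (xs ! c)))))"

definition lex_less :: "nat set \<Rightarrow> nat set \<Rightarrow> bool" where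
  "lex_less I J \<longleftrightarrow>
     (sorted_list_of_set I, sorted_list_of_set J) \<in> lexord {(a, b). a < b}"

definition Gr :: "nat \<Rightarrow> nat \<Rightarrow> (nat \<Rightarrow> 'k::field) set set" where
  "Gr d n = {Y. fs.subspace Y \<and> Y \<subseteq> coord_space {1..n} \<and> fs.dim Y = d}"

definition coord_pr :: "nat set \<Rightarrow> (nat \<Rightarrow> 'k::field) \<Rightarrow> nat \<Rightarrow> 'k" where
  "coord_pr S v = (\<lambda>i. if i \<in> S then 0 else v i)"

definition L_space ::
  "nat \<Rightarrow> nat \<Rightarrow> nat set \<Rightarrow> (nat \<Rightarrow> 'k::field) set \<Rightarrow> (nat \<Rightarrow> 'k) set set" where
  "L_space d n S X = {Y \<in> Gr d n. coord_pr S ` Y \<subseteq> X}"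

text \<open>
  The affine cone, in the space of functions on \<open>d\<close>-subsets of \<open>{1..n}\<close>, over the Pluecker image
  of a set \<open>L\<close> of points of \<open>Gr d n\<close>.  The image is a projective linear subspace iff the cone is a
  linear subspace, and the cone is then its underlying linear space.
\<close>

definition plucker_cone ::
  "nat \<Rightarrow> (nat \<Rightarrow> 'k::field) set set \<Rightarrow> (nat set \<Rightarrow> 'k) set" where
  "plucker_cone n L = insert 0 {p. \<exists>Y\<in>L. plucker_coords (<) {1..n} Y p}"

text \<open>
  A hypergraph is given by the list \<open>hs\<close> of its distinct hyperedges, and an orientation by the
  list \<open>ts\<close> of targets, \<open>ts ! i\<close> being the target of \<open>hs ! i\<close>; list positions start at 0.
\<close>

definition leaf :: "nat set list \<Rightarrow> nat \<Rightarrow> bool" where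
  "leaf hs v \<longleftrightarrow> (\<exists>!h. h \<in> set hs \<and> v \<in> h)"

definition orientation :: "nat set list \<Rightarrow> nat list \<Rightarrow> bool" where
  "orientation hs ts \<longleftrightarrow>
     length ts = length hs \<and> (\<forall>i<length hs. ts ! i \<in> hs ! i) \<and> distinct ts"

definition sources :: "nat set list \<Rightarrow> nat list \<Rightarrow> nat \<Rightarrow> nat set" where
  "sources hs ts i = hs ! i - {ts ! i}"

definition roots :: "nat set list \<Rightarrow> nat list \<Rightarrow> nat set" where
  "roots hs ts = (\<Union>i<length hs. sources hs ts i) - set ts"

definition target_sign :: "nat list \<Rightarrow> int" where
  "target_sign ts = (-1) ^ card {(i, j). i < j \<and> j < length ts \<and> ts ! i > ts ! j}"

definition num_increasing :: "nat set list \<Rightarrow> nat list \<Rightarrow> nat" where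
  "num_increasing hs ts = (\<Sum>i<length hs. card (sources hs ts i \<inter> {1..ts ! i}))"

definition orientation_sign :: "nat set list \<Rightarrow> nat list \<Rightarrow> int" where
  "orientation_sign hs ts = (-1) ^ num_increasing hs ts * target_sign ts"

definition root_sign :: "nat set \<Rightarrow> nat set list \<Rightarrow> nat list \<Rightarrow> int" where
  "root_sign I0 hs ts = (\<Prod>a\<in>I0. (-1) ^ a) * orientation_sign hs ts"

end

theory Submission
  imports Defs "Jordan_Normal_Form.Char_Poly" "HOL-Combinatorics.Multiset_Permutations"
begin

text \<open>
  Put \<open>X' = {v. coord_pr S v \<in> X}\<close>.  The members of \<open>L_space d n S X\<close> are the
  \<open>d\<close>-dimensional subspaces of \<open>X'\<close>.  As \<open>X\<close> projects onto the coordinates in \<open>S\<close>, the space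
  \<open>X'\<close> has dimension \<open>d + 1\<close>, so these members are its hyperplanes.

  \<^bold>\<open>Linearity.\<close>  Let \<open>x\<^sub>0, \<dots>, x\<^sub>d\<close> be a basis of \<open>X'\<close>, taken as the rows of a matrix \<open>x\<close>.  For a
  vector \<open>u\<close> of length \<open>d + 1\<close> and a \<open>d\<close>-set \<open>J\<close> of columns let \<open>[u | x\<^sub>J]\<close> be the columns \<open>J\<close> of
  \<open>x\<close> bordered on the left by \<open>u\<close>.  The Pluecker coordinates of the hyperplane of all combinations
  \<open>\<Sum> a\<^sub>r x\<^sub>r\<close> with \<open>\<Sum> a\<^sub>r u\<^sub>r = 0\<close> are \<open>J \<mapsto> det [u | x\<^sub>J]\<close> up to a scalar.  This expression is linear
  in \<open>u\<close>, and every nonzero \<open>u\<close> occurs, so the cone is a linear space (\<open>cone_eq\<close>).  The cofactors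
  \<open>W\<^sub>r(J)\<close> of the border form a basis of it (\<open>ordered_basis_cone\<close>).  Hence its Pluecker
  coordinates are the determinants of the matrices \<open>W\<close> with entries \<open>W\<^sub>r(J\<^sub>c)\<close>, up to a common
  factor.

  \<^bold>\<open>The formula for\<close> \<open>X'\<close>.  Let \<open>T\<close> be a \<open>(d+1)\<close>-set of columns containing \<open>J\<^sub>i\<^sub>0\<close>.  The transpose
  of \<open>W\<close> times the columns \<open>T\<close> of \<open>x\<close> has the entries \<open>det [x\<^sub>t | x\<^sub>J\<^sub>i]\<close>, where \<open>x\<^sub>t\<close> is the column
  \<open>t \<in> T\<close>.  Such an entry is \<open>0\<close> if \<open>t \<in> J\<^sub>i\<close>, and otherwise it is plus or minus the minor of \<open>x\<close> on
  \<open>J\<^sub>i \<union> {t}\<close>.  In row \<open>i\<^sub>0\<close> the only entry that can be nonzero is therefore plus or minus the minor on \<open>T\<close>.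
  The Leibniz expansion of both sides has that minor as a common factor.  Cancelling it gives
  \<open>det W\<close> as a signed sum, over the listings \<open>t\<^sub>0, \<dots>, t\<^sub>d\<close> of \<open>T\<close> with \<open>t\<^sub>i \<notin> J\<^sub>i\<close>, of products of
  minors over \<open>i \<noteq> i\<^sub>0\<close>.  If the minor on \<open>T\<close> vanishes, the cancellation is made after a polynomial
  deformation of \<open>x\<close> (\<open>det_border_cofactor\<close>).

  \<^bold>\<open>Orientations.\<close>  For \<open>T = [n] \<setminus> I\<^sub>0\<close> these listings are the orientations with set of roots
  \<open>I\<^sub>0\<close> (\<open>orientation_roots_iff\<close>), and the signs agree up to one that depends only on \<open>n\<close> and \<open>d\<close>
  (\<open>root_sign_eq\<close>).

  \<^bold>\<open>Leaves.\<close>  The basis of \<open>X'\<close> can be chosen such that its minor on \<open>I\<close> is \<open>q\<^sub>I / q\<^sub>C\<close> if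
  \<open>S \<subseteq> I\<close> and \<open>0\<close> otherwise (\<open>sorted_minor_adapted\<close>).  A summand then survives iff
  \<open>S \<subseteq> J\<^sub>i \<union> {t\<^sub>i}\<close> for all \<open>i \<noteq> i\<^sub>0\<close>.  For every orientation with roots \<open>I\<^sub>0\<close> this says
  that all elements of \<open>S\<close> are leaves (\<open>leaf_iff\<close>), so either all summands survive or none does.
\<close>

section \<open>Minors and the order of their columns\<close>

definition minor :: "nat \<Rightarrow> (nat \<Rightarrow> 'i \<Rightarrow> 'a::comm_ring_1) \<Rightarrow> 'i list \<Rightarrow> 'a" where
  "minor D x cs = det (mat D D (\<lambda>(r, c). x r (cs ! c)))"

lemma minor_swap:
  assumes "length (ps @ s # t # cs) = D"
  shows "minor D x (ps @ s # t # cs) = - minor D x (ps @ t # s # cs)"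
proof -
  let ?k = "length ps"
  let ?A = "mat D D (\<lambda>(r, c). x r ((ps @ t # s # cs) ! c))"
  have k: "?k < D" "Suc ?k < D" using assms by auto
  have "mat D D (\<lambda>(r, c). x r ((ps @ s # t # cs) ! c)) = swapcols ?k (Suc ?k) ?A"
    using k by (intro eq_matI) (auto simp: nth_append nth_Cons' not_less_eq)
  then show ?thesis
    unfolding minor_def using det_swapcols[of ?k D "Suc ?k" ?A] k by simp
qed

text \<open>
  One step of insertion sort: \<open>t\<close> passes every smaller column by an adjacent swap.  The columns
  \<open>ps\<close> in front stay put; they make the sorting induction below possible with a fixed size \<open>D\<close>.
\<close>
lemma minor_insort:
  fixes t :: "'i::linorder"
  assumes "sorted js" "distinct js" "t \<notin> set js" "length (ps @ t # js) = D"
  shows "minor D x (ps @ t # js) = (-1) ^ card {j \<in> set js. j < t} * minor D x (ps @ insort t js)"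
  using assms
proof (induction js arbitrary: ps)
  case (Cons j js)
  show ?case
  proof (cases "t < j")
    case True
    then have no_less: "{i \<in> set (j # js). i < t} = {}" using Cons.prems by auto
    show ?thesis unfolding no_less using True by (simp add: less_imp_le)
  next
    case False
    then have lt: "j < t" using Cons.prems by auto
    have IH: "minor D x ((ps @ [j]) @ t # js)
        = (-1) ^ card {i \<in> set js. i < t} * minor D x ((ps @ [j]) @ insort t js)"
      using Cons.prems by (intro Cons.IH) auto
    have "{i \<in> set (j # js). i < t} = insert j {i \<in> set js. i < t}" using lt by auto
    then have "card {i \<in> set (j # js). i < t} = Suc (card {i \<in> set js. i < t})"
      using Cons.prems by simp
    then show ?thesis
      using minor_swap[of ps t j js D x] IH lt Cons.prems by simp
  qed
qed simp

text \<open>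
  The inversions of a list are those of its tail together with one for every later entry that is
  smaller than its head, which is the exponent in \<open>minor_insort\<close>.
\<close>
lemma target_sign_Cons:
  assumes "distinct ts"
  shows "target_sign (t # ts) = (-1) ^ card {j \<in> set ts. j < t} * target_sign ts"
proof -
  let ?inv = "\<lambda>ts. {(i, j). i < j \<and> j < length ts \<and> (ts :: nat list) ! i > ts ! j}"
  let ?first = "(\<lambda>j. (0 :: nat, Suc j)) ` {j. j < length ts \<and> ts ! j < t}"
  let ?later = "map_prod Suc Suc ` ?inv ts"
  have fin: "finite (?inv ts)"
    by (rule finite_subset[of _ "{..<length ts} \<times> {..<length ts}"]) auto
  have "?inv (t # ts) = ?first \<union> ?later"
    (is "?l = ?r")
  proof (rule Set.set_eqI)
    fix ij :: "nat \<times> nat"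
    show "ij \<in> ?l \<longleftrightarrow> ij \<in> ?r"
      by (cases ij; cases "fst ij"; cases "snd ij") (auto simp: image_iff)
  qed
  moreover have "card ?first = card {j \<in> set ts. j < t}"
  proof -
    have "card ?first = card {j. j < length ts \<and> ts ! j < t}"
      by (intro card_image inj_onI) auto
    also have "\<dots> = card ((!) ts ` {j. j < length ts \<and> ts ! j < t})"
      using assms by (intro card_image[symmetric] inj_onI) (auto simp: nth_eq_iff_index_eq)
    also have "(!) ts ` {j. j < length ts \<and> ts ! j < t} = {j \<in> set ts. j < t}"
      by (auto simp: in_set_conv_nth)
    finally show ?thesis .
  qed
  moreover have "card ?later = card (?inv ts)"
    by (intro card_image inj_onI) (auto simp: map_prod_def)
  moreover have "card (?first \<union> ?later) = card ?first + card ?later"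
    using fin by (intro card_Un_disjoint) auto
  ultimately show ?thesis
    by (simp add: target_sign_def power_add)
qed

lemma minor_sort:
  assumes "distinct ts" "length (ps @ ts) = D"
  shows "minor D x (ps @ ts) = of_int (target_sign ts) * minor D x (ps @ sort ts)"
  using assms
proof (induction ts arbitrary: ps)
  case Nil
  then show ?case by (simp add: target_sign_def)
next
  case (Cons t ts)
  have "minor D x ((ps @ [t]) @ ts)
      = of_int (target_sign ts) * minor D x ((ps @ [t]) @ sort ts)"
    using Cons.prems by (intro Cons.IH) auto
  moreover have "minor D x (ps @ t # sort ts)
      = (-1) ^ card {j \<in> set ts. j < t} * minor D x (ps @ insort t (sort ts))"
    using minor_insort[of "sort ts" t ps D x] Cons.prems by simp
  ultimately show ?case
    using Cons.prems by (simp add: target_sign_Cons)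
qed

text \<open>
  Both signs are the determinant of the same permutation matrix: sorting its columns gives the
  inversion sign, permuting the rows of the identity gives the other.
\<close>
lemma target_sign_eq_signof:
  assumes p: "p permutes {..<D}" and Ts: "sorted Ts" "distinct Ts" "length Ts = D"
  shows "target_sign (map (\<lambda>i. Ts ! p i) [0..<D]) = signof p"
proof -
  let ?ts = "map (\<lambda>i. Ts ! p i) [0..<D]"
  let ?x = "\<lambda>r c. if c = Ts ! r then 1 else 0 :: int"
  have pD: "p i < D" if "i < D" for i using permutes_in_image[OF p, of i] that by auto
  have set_ts: "set ?ts = set Ts"
  proof -
    have "set ?ts = (!) Ts ` p ` {..<D}" by auto
    also have "\<dots> = set Ts" using permutes_image[OF p] Ts by (auto simp: set_conv_nth)
    finally show ?thesis .
  qed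
  have dist: "distinct ?ts"
    by (rule card_distinct) (use set_ts Ts in \<open>simp add: distinct_card\<close>)
  have sort: "sort ?ts = Ts"
    using set_ts dist Ts by (metis sorted_distinct_set_unique distinct_sort set_sort sorted_sort)
  have idmat: "mat D D (\<lambda>(r, c). ?x r (Ts ! c)) = 1\<^sub>m D"
    using Ts by (intro eq_matI) (auto simp: nth_eq_iff_index_eq)
  have "minor D ?x ?ts = det (transpose_mat (mat D D (\<lambda>(i, j). 1\<^sub>m D $$ (p i, j))))"
    unfolding minor_def
    using Ts pD by (intro arg_cong[of _ _ det] eq_matI) (auto simp: nth_eq_iff_index_eq)
  also have "\<dots> = det (mat D D (\<lambda>(i, j). 1\<^sub>m D $$ (p i, j)) :: int mat)"
    by (rule det_transpose[of _ D]) auto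
  also have "\<dots> = signof p"
    using det_permute_rows[of "1\<^sub>m D :: int mat" D p] p by (simp add: atLeast0LessThan)
  finally have "minor D ?x ?ts = signof p" .
  moreover have "minor D ?x ?ts = target_sign ?ts * minor D ?x Ts"
    using minor_sort[OF dist, of "[]" D ?x] sort by simp
  moreover have "minor D ?x Ts = 1" by (simp add: minor_def idmat)
  ultimately show ?thesis by simp
qed

text \<open>
  The Leibniz formula, summed over the orders in which the column labels can be listed rather than
  over permutations of positions.  Such a listing is what an orientation provides.
\<close>
lemma minor_leibniz:
  fixes x :: "nat \<Rightarrow> nat \<Rightarrow> 'a::comm_ring_1"
  assumes Ts: "sorted Ts" "distinct Ts" "length Ts = D"
  shows "minor D x Ts = (\<Sum>ts \<in> permutations_of_set (set Ts).
           of_int (target_sign ts) * (\<Prod>i<D. x i (ts ! i)))"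
proof -
  let ?list = "\<lambda>p. map (\<lambda>i. Ts ! p i) [0..<D]"
  let ?P = "{p. p permutes {..<D}}"
  have "inj_on ?list ?P"
  proof (rule inj_onI)
    fix p p' assume p: "p \<in> ?P" "p' \<in> ?P" and eq: "?list p = ?list p'"
    have "p i = p' i" if "i < D" for i
    proof -
      have "Ts ! p i = Ts ! p' i" using arg_cong[OF eq, of "\<lambda>l. l ! i"] that by simp
      moreover have "p i < D" "p' i < D"
        using p that by (auto dest: permutes_in_image[of _ _ i])
      ultimately show ?thesis using Ts by (simp add: nth_eq_iff_index_eq)
    qed
    moreover have "p i = p' i" if "\<not> i < D" for i
      using p that by (auto simp: permutes_not_in)
    ultimately show "p = p'" by blast
  qed
  moreover have "?list ` ?P \<subseteq> permutations_of_set (set Ts)"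
  proof safe
    fix p assume p: "p permutes {..<D}"
    have "set (?list p) = (!) Ts ` p ` {..<D}" by auto
    also have "\<dots> = set Ts" using permutes_image[OF p] Ts by (auto simp: set_conv_nth)
    finally have "set (?list p) = set Ts" .
    moreover from this have "distinct (?list p)"
      by (intro card_distinct) (use Ts in \<open>simp add: distinct_card\<close>)
    ultimately show "?list p \<in> permutations_of_set (set Ts)"
      by (simp add: permutations_of_set_def)
  qed
  moreover have "card ?P = card (permutations_of_set (set Ts))"
    using Ts by (simp add: card_permutations distinct_card)
  ultimately have bij: "bij_betw ?list ?P (permutations_of_set (set Ts))"
    by (metis bij_betw_def card_image card_subset_eq finite_permutations_of_set)
  have "minor D x Ts = (\<Sum>p\<in>?P. signof p * (\<Prod>i<D. x i (Ts ! p i)))"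
    unfolding minor_def
    by (subst det_def'[of _ D])
       (auto simp: atLeast0LessThan intro!: sum.cong prod.cong dest: permutes_in_image)
  also have "\<dots> = (\<Sum>p\<in>?P. of_int (target_sign (?list p)) * (\<Prod>i<D. x i (?list p ! i)))"
  proof (rule sum.cong)
    fix p assume "p \<in> ?P"
    then have "of_int (target_sign (?list p)) = (signof p :: 'a)"
      using target_sign_eq_signof[OF _ Ts, of p] by (simp add: sign_def)
    then show "signof p * (\<Prod>i<D. x i (Ts ! p i))
        = of_int (target_sign (?list p)) * (\<Prod>i<D. x i (?list p ! i))"
      by simp
  qed simp
  also have "\<dots> = (\<Sum>ts \<in> permutations_of_set (set Ts).
           of_int (target_sign ts) * (\<Prod>i<D. x i (ts ! i)))"
    by (rule sum.reindex_bij_betw[OF bij])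
  finally show ?thesis .
qed

section \<open>Bordering a maximal minor by a column\<close>

definition sorted_minor :: "nat \<Rightarrow> (nat \<Rightarrow> nat \<Rightarrow> 'a::comm_ring_1) \<Rightarrow> nat set \<Rightarrow> 'a" where
  "sorted_minor D x I = minor D x (sorted_list_of_set I)"

definition bordered ::
  "nat \<Rightarrow> (nat \<Rightarrow> nat \<Rightarrow> 'a::comm_ring_1) \<Rightarrow> (nat \<Rightarrow> 'a) \<Rightarrow> nat set \<Rightarrow> 'a" where
  "bordered D x u J =
     det (mat D D (\<lambda>(r, c). if c = 0 then u r else x r (sorted_list_of_set J ! (c - 1))))"

text \<open>
  By expansion along the border, \<open>border_cofactor D x r J\<close> is, up to sign, the minor on the columns
  \<open>J\<close> of the matrix \<open>x\<close> without row \<open>r\<close>: a Pluecker coordinate of a coordinate hyperplane.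
\<close>
definition border_cofactor :: "nat \<Rightarrow> (nat \<Rightarrow> nat \<Rightarrow> 'a::comm_ring_1) \<Rightarrow> nat \<Rightarrow> nat set \<Rightarrow> 'a" where
  "border_cofactor D x r J = bordered D x (\<lambda>i. if i = r then 1 else 0) J"

lemma bordered_expand:
  assumes "D > 0"
  shows "bordered D x u J = (\<Sum>r<D. u r * border_cofactor D x r J)"
proof -
  let ?M = "\<lambda>u. mat D D (\<lambda>(r, c). if c = 0 then u r else x r (sorted_list_of_set J ! (c - 1)))"
  let ?cof = "cofactor (?M (\<lambda>_. 0))"
  have del: "mat_delete (?M u) r 0 = mat_delete (?M (\<lambda>_. 0)) r 0" for u r
    using assms by (intro eq_matI) (auto simp: mat_delete_def)
  have cof: "cofactor (?M u) r 0 = ?cof r 0" for u r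
    by (simp only: cofactor_def del[of u])
  have exp: "bordered D x u J = (\<Sum>r<D. u r * ?cof r 0)" for u
    unfolding bordered_def
    by (subst laplace_expansion_column[of _ D 0])
       (use assms in \<open>auto simp: cof[of u] intro!: sum.cong\<close>)
  have "border_cofactor D x r J = ?cof r 0" if "r < D" for r
    using that by (simp add: border_cofactor_def exp if_distrib[of "\<lambda>a. a * _"] cong: if_cong)
  then show ?thesis by (simp add: exp)
qed

lemma bordered_eq_minor:
  "bordered D x (\<lambda>r. x r t) J = minor D x (t # sorted_list_of_set J)"
  unfolding bordered_def minor_def
  by (rule arg_cong[of _ _ det], rule eq_matI) (auto simp: nth_Cons')

lemma bordered_column_in:
  assumes "finite J" "Suc (card J) = D" "t \<in> J"
  shows "bordered D x (\<lambda>r. x r t) J = 0"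
proof -
  obtain k where k: "k < card J" "sorted_list_of_set J ! k = t"
    using assms by (metis in_set_conv_nth length_sorted_list_of_set set_sorted_list_of_set)
  show ?thesis
    unfolding bordered_def
    by (rule det_identical_columns[of _ D 0 "Suc k"])
       (use assms k in \<open>auto simp: col_def intro!: eq_vecI\<close>)
qed

lemma bordered_column_notin:
  assumes "finite J" "Suc (card J) = D" "t \<notin> J"
  shows "bordered D x (\<lambda>r. x r t) J = (-1) ^ card {j \<in> J. j < t} * sorted_minor D x (insert t J)"
  using minor_insort[of "sorted_list_of_set J" t "[]" D x] assms
  by (simp add: bordered_eq_minor sorted_minor_def)

text \<open>
  Multiplicativity of the determinant: by linearity in the border, the product of the transposed
  matrix of cofactors with the columns \<open>T\<close> of \<open>x\<close> consists of bordered determinants whose borders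
  are columns of \<open>x\<close> themselves.
\<close>
lemma det_border_cofactor_mult_minor:
  assumes "D > 0"
  shows "minor D (border_cofactor D x) Js * sorted_minor D x T
       = minor D (\<lambda>i t. bordered D x (\<lambda>r. x r t) (Js ! i)) (sorted_list_of_set T)"
proof -
  let ?T = "sorted_list_of_set T"
  let ?W = "mat D D (\<lambda>(r, c). border_cofactor D x r (Js ! c))"
  let ?X = "mat D D (\<lambda>(r, c). x r (?T ! c))"
  have "transpose_mat ?W * ?X
      = mat D D (\<lambda>(i, c). bordered D x (\<lambda>r. x r (?T ! c)) (Js ! i))"
    by (intro eq_matI)
       (auto simp: scalar_prod_def bordered_expand[OF assms] atLeast0LessThan mult.commute
             intro!: sum.cong)
  moreover have "det (transpose_mat ?W * ?X) = det ?W * det ?X"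
    by (simp add: det_mult[of _ D] det_transpose[of _ D])
  ultimately show ?thesis by (simp add: minor_def sorted_minor_def)
qed

text \<open>
  The orientation sum in terms of minors: \<open>ts ! i\<close> is read as the target of the edge complementary to
  \<open>Js ! i\<close>, and the condition on \<open>ts\<close> says that it belongs to that edge.
\<close>
definition target_list_sum ::
  "nat \<Rightarrow> (nat \<Rightarrow> nat \<Rightarrow> 'a::comm_ring_1) \<Rightarrow> nat set list \<Rightarrow> nat \<Rightarrow> nat set \<Rightarrow> 'a" where
  "target_list_sum D x Js i0 T =
     (\<Sum>ts | ts \<in> permutations_of_set T \<and> (\<forall>i<D. ts ! i \<notin> Js ! i).
        of_int (target_sign ts) * (\<Prod>i<D. (-1) ^ card {j \<in> Js ! i. j < ts ! i}) *
        (\<Prod>i\<in>{..<D} - {i0}. sorted_minor D x (insert (ts ! i) (Js ! i))))"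

text \<open>
  In the Leibniz expansion of the product above every nonzero summand contains the minor on \<open>T\<close>,
  contributed by the position \<open>i0\<close>: as \<open>Js ! i0 \<subseteq> T\<close> lacks just one element of \<open>T\<close>, adding
  the target \<open>ts ! i0\<close> gives \<open>T\<close> back.
\<close>
lemma det_border_cofactor_cancel:
  assumes D: "D > 0" and Js: "\<And>i. i < D \<Longrightarrow> finite (Js ! i) \<and> Suc (card (Js ! i)) = D"
    and T: "finite T" "card T = D" and i0: "i0 < D" "Js ! i0 \<subseteq> T"
  shows "minor D (border_cofactor D x) Js * sorted_minor D x T = target_list_sum D x Js i0 T * sorted_minor D x T"
proof -
  let ?N = "\<lambda>i t. bordered D x (\<lambda>r. x r t) (Js ! i)"
  let ?s = "\<lambda>i t. (-1) ^ card {j \<in> Js ! i. j < t} :: 'a"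
  have "minor D (border_cofactor D x) Js * sorted_minor D x T
      = (\<Sum>ts\<in>permutations_of_set T. of_int (target_sign ts) * (\<Prod>i<D. ?N i (ts ! i)))"
    using det_border_cofactor_mult_minor[OF D, of x Js T] minor_leibniz[of "sorted_list_of_set T" D ?N] T
    by simp
  also have "\<dots> = (\<Sum>ts | ts \<in> permutations_of_set T \<and> (\<forall>i<D. ts ! i \<notin> Js ! i).
       of_int (target_sign ts) * (\<Prod>i<D. ?N i (ts ! i)))"
  proof (rule sum.mono_neutral_right)
    show "\<forall>ts \<in> permutations_of_set T
        - {ts. ts \<in> permutations_of_set T \<and> (\<forall>i<D. ts ! i \<notin> Js ! i)}.
      of_int (target_sign ts) * (\<Prod>i<D. ?N i (ts ! i)) = 0"
    proof
      fix ts assume "ts \<in> permutations_of_set T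
        - {ts. ts \<in> permutations_of_set T \<and> (\<forall>i<D. ts ! i \<notin> Js ! i)}"
      then obtain i where "i < D" "ts ! i \<in> Js ! i" by auto
      then have "(\<Prod>i<D. ?N i (ts ! i)) = 0"
        using Js[of i] bordered_column_in[of "Js ! i" D "ts ! i" x]
        by (intro prod_zero bexI[of _ i]) auto
      then show "of_int (target_sign ts) * (\<Prod>i<D. ?N i (ts ! i)) = 0" by simp
    qed
  qed auto
  also have "\<dots> = (\<Sum>ts | ts \<in> permutations_of_set T \<and> (\<forall>i<D. ts ! i \<notin> Js ! i).
       of_int (target_sign ts) * (\<Prod>i<D. ?s i (ts ! i)) *
        (\<Prod>i\<in>{..<D} - {i0}. sorted_minor D x (insert (ts ! i) (Js ! i))) * sorted_minor D x T)"
  proof (rule sum.cong)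
    fix ts assume "ts \<in> {ts. ts \<in> permutations_of_set T \<and> (\<forall>i<D. ts ! i \<notin> Js ! i)}"
    then have ts: "set ts = T" "distinct ts" "\<And>i. i < D \<Longrightarrow> ts ! i \<notin> Js ! i"
      by (auto simp: permutations_of_set_def)
    have len: "length ts = D" using ts T by (metis distinct_card)
    have "insert (ts ! i0) (Js ! i0) = T"
    proof (rule card_subset_eq[OF T(1)])
      show "insert (ts ! i0) (Js ! i0) \<subseteq> T" using i0 ts len by auto
      show "card (insert (ts ! i0) (Js ! i0)) = card T"
        using Js[OF i0(1)] ts(3)[OF i0(1)] T by simp
    qed
    then have "(\<Prod>i<D. sorted_minor D x (insert (ts ! i) (Js ! i)))
        = sorted_minor D x T * (\<Prod>i\<in>{..<D} - {i0}. sorted_minor D x (insert (ts ! i) (Js ! i)))"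
      using i0 by (subst prod.remove[of _ i0]) auto
    moreover have "(\<Prod>i<D. ?N i (ts ! i))
        = (\<Prod>i<D. ?s i (ts ! i) * sorted_minor D x (insert (ts ! i) (Js ! i)))"
      using Js ts by (intro prod.cong) (auto simp: bordered_column_notin)
    ultimately show "of_int (target_sign ts) * (\<Prod>i<D. ?N i (ts ! i))
      = of_int (target_sign ts) * (\<Prod>i<D. ?s i (ts ! i)) *
        (\<Prod>i\<in>{..<D} - {i0}. sorted_minor D x (insert (ts ! i) (Js ! i))) * sorted_minor D x T"
      by (simp add: prod.distrib mult_ac)
  qed simp
  finally show ?thesis by (simp add: target_list_sum_def sum_distrib_right)
qed

context comm_ring_hom
begin

lemma hom_minor: "hom (minor D x cs) = minor D (\<lambda>r c. hom (x r c)) cs"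
  unfolding minor_def hom_det[symmetric] by (intro arg_cong[of _ _ det] eq_matI) auto

lemma hom_border_cofactor: "hom (border_cofactor D x r J) = border_cofactor D (\<lambda>r c. hom (x r c)) r J"
  unfolding border_cofactor_def bordered_def hom_det[symmetric]
  by (intro arg_cong[of _ _ det] eq_matI) auto

lemma hom_target_list_sum: "hom (target_list_sum D x Js i0 T) = target_list_sum D (\<lambda>r c. hom (x r c)) Js i0 T"
  by (simp add: target_list_sum_def sorted_minor_def hom_sum hom_prod hom_minor hom_mult hom_power hom_uminus
      hom_of_int)

end

text \<open>
  To cancel the minor on \<open>T\<close> when it may vanish, add an indeterminate to the entries on the diagonal
  of the columns \<open>T\<close>.  Their minor becomes a characteristic polynomial, which is monic and hence
  cancellable; the cancelled identity is then evaluated at \<open>0\<close>.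
\<close>
lemma det_border_cofactor:
  fixes x :: "nat \<Rightarrow> nat \<Rightarrow> 'a::idom"
  assumes D: "D > 0" and Js: "\<And>i. i < D \<Longrightarrow> finite (Js ! i) \<and> Suc (card (Js ! i)) = D"
    and T: "finite T" "card T = D" and i0: "i0 < D" "Js ! i0 \<subseteq> T"
  shows "minor D (border_cofactor D x) Js = target_list_sum D x Js i0 T"
proof -
  let ?T = "sorted_list_of_set T"
  let ?A = "mat D D (\<lambda>(r, c). - x r (?T ! c))"
  define y where "y r c = [:x r c:] + (if c = ?T ! r then [:0, 1:] else 0)" for r c
  have "mat D D (\<lambda>(r, c). y r (?T ! c)) = char_poly_matrix ?A"
    using T by (intro eq_matI) (auto simp: char_poly_matrix_def y_def nth_eq_iff_index_eq)
  then have "sorted_minor D y T = char_poly ?A"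
    by (simp add: sorted_minor_def minor_def char_poly_def)
  then have nz: "sorted_minor D y T \<noteq> 0"
    using degree_monic_char_poly[of ?A D] by auto
  then have "minor D (border_cofactor D y) Js = target_list_sum D y Js i0 T"
    using det_border_cofactor_cancel[OF D Js T i0, of y] by simp
  then have "poly (minor D (border_cofactor D y) Js) 0 = poly (target_list_sum D y Js i0 T) 0" by simp
  moreover have "poly (y r c) 0 = x r c" for r c by (simp add: y_def)
  ultimately show ?thesis
    by (simp add: poly_hom.hom_minor poly_hom.hom_border_cofactor poly_hom.hom_target_list_sum)
qed

section \<open>Orientations with prescribed roots\<close>

lemma leaf_iff_unique_index:
  assumes "distinct hs"
  shows "leaf hs v \<longleftrightarrow> (\<exists>!i. i < length hs \<and> v \<in> hs ! i)"
proof
  assume "leaf hs v"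
  then obtain h where h: "h \<in> set hs" "v \<in> h" and uniq: "\<And>h'. h' \<in> set hs \<Longrightarrow> v \<in> h' \<Longrightarrow> h' = h"
    unfolding leaf_def by blast
  obtain i where i: "i < length hs" "hs ! i = h" using h(1) by (auto simp: in_set_conv_nth)
  have "j = i" if "j < length hs" "v \<in> hs ! j" for j
    using uniq[OF nth_mem that(2)] that(1) i assms nth_eq_iff_index_eq[of hs j i] by simp
  then show "\<exists>!i. i < length hs \<and> v \<in> hs ! i" using i h(2) by blast
next
  assume "\<exists>!i. i < length hs \<and> v \<in> hs ! i"
  then obtain i where i: "i < length hs" "v \<in> hs ! i"
    and uniq: "\<And>j. j < length hs \<Longrightarrow> v \<in> hs ! j \<Longrightarrow> j = i"
    by blast
  have "h = hs ! i" if "h \<in> set hs" "v \<in> h" for h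
    using that uniq by (metis in_set_conv_nth)
  then show "leaf hs v" unfolding leaf_def using i by (metis nth_mem)
qed

text \<open>
  The discrepancy between the sign attached to an orientation and the sign of its summand in the
  expansion of the determinant.  It depends neither on the hypergraph nor on the roots.
\<close>
definition ambient_sign :: "nat \<Rightarrow> nat \<Rightarrow> int" where
  "ambient_sign n d = (-1) ^ Suc d * (\<Prod>a\<in>{1..n}. (-1) ^ a)"

context
  fixes n d :: nat and Js hs :: "nat set list" and i0 :: nat and I0 :: "nat set"
  assumes d: "d < n"
    and Js: "length Js = Suc d" "set Js \<subseteq> nsets {1..n} d"
    and hs: "hs = map (\<lambda>J. {1..n} - J) Js"
    and i0: "i0 < Suc d"
    and I0: "I0 \<subseteq> hs ! i0" "card I0 = n - d - 1"
begin

lemma Js_nth: "i < Suc d \<Longrightarrow> Js ! i \<subseteq> {1..n} \<and> finite (Js ! i) \<and> card (Js ! i) = d"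
  using subsetD[OF Js(2) nth_mem[of i Js]] Js(1) by (simp add: nsets_def)

lemma hs_nth: "i < Suc d \<Longrightarrow> hs ! i = {1..n} - Js ! i"
  using Js by (simp add: hs)

lemma I0_subset: "I0 \<subseteq> {1..n}"
  using I0 hs_nth[OF i0] by auto

lemma card_nonroots: "card ({1..n} - I0) = Suc d"
  using I0_subset I0 d by (subst card_Diff_subset) (auto dest: finite_subset)

text \<open>
  With \<open>n - d - 1\<close> roots no vertex is left over: the \<open>d + 1\<close> targets fill the complement of \<open>I0\<close>.
  Conversely, if they do, then every vertex of \<open>I0\<close> is a source of the edge \<open>hs ! i0\<close>.
\<close>
lemma orientation_roots_iff:
  "orientation hs ts \<and> roots hs ts = I0 \<longleftrightarrow>
     ts \<in> permutations_of_set ({1..n} - I0) \<and> (\<forall>i<Suc d. ts ! i \<notin> Js ! i)"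
  (is "?l \<longleftrightarrow> ?r")
proof
  assume ?l
  then have ts: "length ts = Suc d" "\<And>i. i < Suc d \<Longrightarrow> ts ! i \<in> {1..n} - Js ! i"
    "distinct ts" and roots: "roots hs ts = I0"
    using Js hs_nth by (auto simp: orientation_def hs)
  have "set ts \<subseteq> {1..n} - I0"
    using ts roots by (auto simp: roots_def in_set_conv_nth)
  then have "set ts = {1..n} - I0"
    using ts card_nonroots by (intro card_subset_eq) (auto simp: distinct_card)
  then show ?r using ts by (auto simp: permutations_of_set_def)
next
  assume ?r
  then have ts: "set ts = {1..n} - I0" "distinct ts" "\<And>i. i < Suc d \<Longrightarrow> ts ! i \<notin> Js ! i"
    by (auto simp: permutations_of_set_def)
  then have len: "length ts = Suc d" using card_nonroots by (metis distinct_card)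
  have mem: "ts ! i \<in> {1..n} - I0" if "i < Suc d" for i
    using that len ts(1) nth_mem[of i ts] by auto
  have "orientation hs ts"
    using len ts mem Js hs_nth by (auto simp: orientation_def hs)
  moreover have "roots hs ts = I0"
  proof
    show "roots hs ts \<subseteq> I0"
      using ts Js hs_nth by (auto simp: roots_def sources_def hs)
    show "I0 \<subseteq> roots hs ts"
    proof
      fix v assume v: "v \<in> I0"
      then have "v \<in> sources hs ts i0" using I0 mem[OF i0] by (auto simp: sources_def)
      then show "v \<in> roots hs ts" using v ts i0 Js by (auto simp: roots_def hs)
    qed
  qed
  ultimately show ?l ..
qed

lemma non_sources:
  assumes "orientation hs ts" "i < Suc d"
  shows "{1..n} - sources hs ts i = insert (ts ! i) (Js ! i)"
  using assms Js_nth[of i] hs_nth[of i] Js by (auto simp: sources_def orientation_def hs)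

text \<open>
  An edge with target \<open>t\<close> and complement \<open>J\<close> has \<open>t - 1 - card {j \<in> J. j < t}\<close> sources below \<open>t\<close>.
  The factors \<open>(-1)^t\<close> range over the complement of \<open>I0\<close>, so the sign of \<open>I0\<close> completes them to a
  product over all vertices.
\<close>
lemma root_sign_eq:
  assumes ts: "orientation hs ts" "roots hs ts = I0"
  shows "root_sign I0 hs ts
    = ambient_sign n d * (target_sign ts * (\<Prod>i<Suc d. (-1) ^ card {j \<in> Js ! i. j < ts ! i}))"
proof -
  let ?c = "\<lambda>i. card {j \<in> Js ! i. j < ts ! i}"
  let ?s = "\<lambda>i. card (sources hs ts i \<inter> {1..ts ! i})"
  have perm: "set ts = {1..n} - I0" "distinct ts"
    using orientation_roots_iff ts by (auto simp: permutations_of_set_def)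
  have len: "length ts = Suc d" using ts Js by (simp add: orientation_def hs)
  have edge: "(-1) ^ ?s i = (-1 :: int) * (-1) ^ (ts ! i) * (-1) ^ ?c i" if i: "i < Suc d" for i
  proof -
    have t: "ts ! i \<in> {1..n} - Js ! i"
      using ts i Js hs_nth[OF i] by (auto simp: orientation_def hs)
    have "{1..ts ! i} = (sources hs ts i \<inter> {1..ts ! i}) \<union> insert (ts ! i) {j \<in> Js ! i. j < ts ! i}"
      using t Js_nth[OF i] hs_nth[OF i] by (auto simp: sources_def)
    then have "ts ! i = card ((sources hs ts i \<inter> {1..ts ! i})
        \<union> insert (ts ! i) {j \<in> Js ! i. j < ts ! i})"
      by (metis card_atLeastAtMost diff_Suc_1)
    also have "\<dots> = ?s i + card (insert (ts ! i) {j \<in> Js ! i. j < ts ! i})"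
      using Js_nth[OF i] hs_nth[OF i] t
      by (intro card_Un_disjoint) (auto simp: sources_def)
    also have "\<dots> = ?s i + ?c i + 1" using Js_nth[OF i] by simp
    finally have "ts ! i = ?s i + ?c i + 1" .
    then have "(-1 :: int) ^ (ts ! i) = (-1) ^ (?s i + ?c i + 1)" by presburger
    then show ?thesis by (simp add: power_add mult.assoc flip: power_mult_distrib)
  qed
  have "(-1 :: int) ^ num_increasing hs ts = (\<Prod>i<Suc d. (-1) ^ ?s i)"
    using Js by (simp add: num_increasing_def power_sum hs del: sum.lessThan_Suc prod.lessThan_Suc)
  also have "\<dots> = (\<Prod>i<Suc d. (-1) * (-1) ^ (ts ! i) * (-1) ^ ?c i)"
    using edge by (intro prod.cong) auto
  also have "\<dots> = (-1) ^ Suc d * (\<Prod>i<Suc d. (-1) ^ (ts ! i)) * (\<Prod>i<Suc d. (-1) ^ ?c i)"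
    by (simp only: prod.distrib prod_constant card_lessThan)
  also have "(\<Prod>i<Suc d. (-1 :: int) ^ (ts ! i)) = (\<Prod>a\<in>{1..n} - I0. (-1) ^ a)"
    using bij_betw_nth[OF perm(2) refl refl] perm(1) len
      prod.reindex_bij_betw[of "(!) ts" "{..<Suc d}" "{1..n} - I0" "\<lambda>a. (-1 :: int) ^ a"]
    by simp
  finally have inc: "(-1 :: int) ^ num_increasing hs ts
    = (-1) ^ Suc d * (\<Prod>a\<in>{1..n} - I0. (-1) ^ a) * (\<Prod>i<Suc d. (-1) ^ ?c i)" .
  have "(\<Prod>a\<in>{1..n}. (-1 :: int) ^ a) = (\<Prod>a\<in>{1..n} - I0. (-1) ^ a) * (\<Prod>a\<in>I0. (-1) ^ a)"
    using I0_subset by (intro prod.subset_diff) auto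
  then show ?thesis
    unfolding root_sign_def orientation_sign_def ambient_sign_def inc by (simp only: mult_ac)
qed

text \<open>
  The edge \<open>i0\<close> consists of the roots and its own target.  If \<open>v\<close> lies in that edge, the right-hand
  side says that no other edge contains \<open>v\<close>: it would have to have \<open>v\<close> as its target, but \<open>v\<close> is a
  root or the target of the edge \<open>i0\<close>.  If \<open>v\<close> is not in that edge, it is the target of exactly one
  other edge, and the right-hand side says that this is the only edge containing it.
\<close>
lemma leaf_iff:
  assumes ts: "orientation hs ts" "roots hs ts = I0" and "distinct Js" and v: "v \<in> {1..n}"
  shows "leaf hs v \<longleftrightarrow> (\<forall>i\<in>{..<Suc d} - {i0}. v \<in> insert (ts ! i) (Js ! i))"
proof -
  have perm: "set ts = {1..n} - I0" "distinct ts"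
    using orientation_roots_iff ts by (auto simp: permutations_of_set_def)
  have len: "length ts = Suc d" using ts Js by (simp add: orientation_def hs)
  have t: "ts ! i \<in> {1..n} - Js ! i" if "i < Suc d" for i
    using ts that Js hs_nth[OF that] by (auto simp: orientation_def hs)
  have I0_J: "I0 \<inter> Js ! i0 = {}" using I0 hs_nth[OF i0] by auto
  have J_i0: "Js ! i0 = {1..n} - I0 - {ts ! i0}"
  proof (rule card_subset_eq)
    show "Js ! i0 \<subseteq> {1..n} - I0 - {ts ! i0}" using I0_J Js_nth[OF i0] t[OF i0] by auto
    have "ts ! i0 \<in> {1..n} - I0" using perm len i0 nth_mem[of i0 ts] by auto
    then show "card (Js ! i0) = card ({1..n} - I0 - {ts ! i0})"
      using card_nonroots Js_nth[OF i0] by simp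
  qed simp
  have "inj_on (\<lambda>J. {1..n} - J) (set Js)"
  proof (rule inj_onI)
    fix J J' assume "J \<in> set Js" "J' \<in> set Js" "{1..n} - J = {1..n} - J'"
    moreover from this have "J \<subseteq> {1..n}" "J' \<subseteq> {1..n}" using Js by (auto simp: nsets_def)
    ultimately show "J = J'" by (metis double_diff subset_refl)
  qed
  then have "distinct hs" using \<open>distinct Js\<close> by (simp add: hs distinct_map)
  have in_hs: "i < Suc d \<and> v \<notin> Js ! i \<longleftrightarrow> i < length hs \<and> v \<in> hs ! i" for i
    using v Js hs_nth by (auto simp: hs)
  have leaf: "leaf hs v \<longleftrightarrow> (\<exists>!i. i < Suc d \<and> v \<notin> Js ! i)"
    using leaf_iff_unique_index[OF \<open>distinct hs\<close>, of v] by (simp only: in_hs)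
  show ?thesis
  proof
    assume "leaf hs v"
    then have "\<exists>!i. i < Suc d \<and> v \<notin> Js ! i" by (simp only: leaf)
    then obtain k where "k < Suc d \<and> v \<notin> Js ! k" "\<forall>i. i < Suc d \<and> v \<notin> Js ! i \<longrightarrow> i = k"
      by (elim ex1E) (rule that)
    then have k: "k < Suc d" "v \<notin> Js ! k" "\<And>i. i < Suc d \<Longrightarrow> v \<notin> Js ! i \<Longrightarrow> i = k"
      by blast+
    show "\<forall>i\<in>{..<Suc d} - {i0}. v \<in> insert (ts ! i) (Js ! i)"
    proof (intro ballI, rule ccontr)
      fix i assume i: "i \<in> {..<Suc d} - {i0}" and not: "v \<notin> insert (ts ! i) (Js ! i)"
      then have ik: "i = k" using k(3)[of i] by auto
      then have "v \<in> Js ! i0" using k(3)[OF i0] i by auto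
      then have "v \<in> set ts" using J_i0 perm by auto
      then obtain j where j: "j < Suc d" "v = ts ! j" using len by (auto simp: in_set_conv_nth)
      then have "j = k" using k(3)[of j] t[of j] by auto
      then show False using j not ik by auto
    qed
  next
    assume all: "\<forall>i\<in>{..<Suc d} - {i0}. v \<in> insert (ts ! i) (Js ! i)"
    show "leaf hs v"
    proof (cases "v \<in> Js ! i0")
      case True
      then have "v \<in> set ts" using J_i0 perm by auto
      then obtain j where j: "j < Suc d" "v = ts ! j" using len by (auto simp: in_set_conv_nth)
      have "i = j" if "i < Suc d" "v \<notin> Js ! i" for i
      proof -
        have "v = ts ! i" using that True all by auto
        then show ?thesis using j that len perm by (simp add: nth_eq_iff_index_eq)
      qed
      moreover have "v \<notin> Js ! j" using j t by blast
      ultimately show ?thesis using j(1) unfolding leaf by (intro ex1I[of _ j]) blast+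
    next
      case False
      have "i = i0" if i: "i < Suc d" "v \<notin> Js ! i" for i
      proof (rule ccontr)
        assume ne: "i \<noteq> i0"
        then have vi: "v = ts ! i" using all i by auto
        then have "v \<in> set ts" using i len by auto
        then have "v = ts ! i0" using False J_i0 perm by auto
        then show False using vi ne i i0 len perm by (simp add: nth_eq_iff_index_eq)
      qed
      then show ?thesis unfolding leaf using False i0 by (intro ex1I[of _ i0]) blast+
    qed
  qed
qed

text \<open>
  The dichotomy between the two cases of the formula: by \<open>leaf_iff\<close>, if the minors of \<open>x\<close> vanish off
  the supersets of \<open>S\<close>, then the product for an orientation keeps all its factors or vanishes
  according to a condition that does not mention the orientation.
\<close>
lemma target_list_sum_eq:
  fixes q :: "nat set \<Rightarrow> 'a::comm_ring_1"
  assumes "distinct Js" "S \<subseteq> {1..n}"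
    and minors: "\<And>I. I \<in> nsets {1..n} (Suc d) \<Longrightarrow> sorted_minor (Suc d) x I = (if S \<subseteq> I then a * q I else 0)"
  shows "target_list_sum (Suc d) x Js i0 ({1..n} - I0) = of_int (ambient_sign n d) * a ^ d *
    (if \<forall>v\<in>S. leaf hs v
     then (\<Sum>ts | orientation hs ts \<and> roots hs ts = I0.
             of_int (root_sign I0 hs ts) *
             (\<Prod>i\<in>{..<Suc d} - {i0}. q ({1..n} - sources hs ts i)))
     else 0)"
proof -
  let ?c = "\<lambda>ts i. card {j \<in> Js ! i. j < ts ! i}"
  let ?O = "{ts. orientation hs ts \<and> roots hs ts = I0}"
  have sq: "ambient_sign n d * ambient_sign n d = 1"
    by (simp add: ambient_sign_def mult_ac flip: power_mult_distrib prod.distrib)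
  have summand: "of_int (target_sign ts) * (\<Prod>i<Suc d. (-1) ^ ?c ts i) *
        (\<Prod>i\<in>{..<Suc d} - {i0}. sorted_minor (Suc d) x (insert (ts ! i) (Js ! i)))
      = of_int (ambient_sign n d) * a ^ d * (if \<forall>v\<in>S. leaf hs v then of_int (root_sign I0 hs ts) *
             (\<Prod>i\<in>{..<Suc d} - {i0}. q ({1..n} - sources hs ts i)) else 0)"
    if ts: "ts \<in> ?O" for ts
  proof -
    have "ambient_sign n d * root_sign I0 hs ts
        = target_sign ts * (\<Prod>i<Suc d. (-1) ^ ?c ts i)"
      using ts root_sign_eq[of ts] sq by (simp only: mem_Collect_eq mult.assoc[symmetric] mult_1)
    from arg_cong[OF this, of "of_int :: int \<Rightarrow> 'a"]
    have sign: "of_int (ambient_sign n d) * of_int (root_sign I0 hs ts)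
        = of_int (target_sign ts) * (\<Prod>i<Suc d. (-1 :: 'a) ^ ?c ts i)"
      by (simp only: of_int_mult of_int_prod of_int_power of_int_minus of_int_1)
    have mem: "insert (ts ! i) (Js ! i) \<in> nsets {1..n} (Suc d)" if "i < Suc d" for i
      using ts that Js_nth[OF that] hs_nth[OF that] Js
      by (auto simp: nsets_def orientation_def hs)
    have "(\<Prod>i\<in>{..<Suc d} - {i0}. sorted_minor (Suc d) x (insert (ts ! i) (Js ! i)))
        = (\<Prod>i\<in>{..<Suc d} - {i0}. if S \<subseteq> insert (ts ! i) (Js ! i)
              then a * q ({1..n} - sources hs ts i) else 0)"
      using ts mem non_sources[of ts] by (intro prod.cong) (simp_all add: minors)
    also have "\<dots> = (if \<forall>v\<in>S. leaf hs v
        then a ^ d * (\<Prod>i\<in>{..<Suc d} - {i0}. q ({1..n} - sources hs ts i)) else 0)"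
    proof -
      have leaf: "(\<forall>v\<in>S. leaf hs v) \<longleftrightarrow> (\<forall>i\<in>{..<Suc d} - {i0}. S \<subseteq> insert (ts ! i) (Js ! i))"
        using leaf_iff[of ts] ts assms(1,2) by blast
      show ?thesis
      proof (cases "\<forall>v\<in>S. leaf hs v")
        case True
        then have "(\<Prod>i\<in>{..<Suc d} - {i0}. if S \<subseteq> insert (ts ! i) (Js ! i)
              then a * q ({1..n} - sources hs ts i) else 0)
          = (\<Prod>i\<in>{..<Suc d} - {i0}. a * q ({1..n} - sources hs ts i))"
          unfolding leaf by (intro prod.cong) auto
        then show ?thesis using True i0 by (simp add: prod.distrib)
      next
        case False
        then obtain i where "i \<in> {..<Suc d} - {i0}" "\<not> S \<subseteq> insert (ts ! i) (Js ! i)"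
          unfolding leaf by blast
        then show ?thesis using False by (subst prod_zero) auto
      qed
    qed
    finally show ?thesis
      unfolding sign[symmetric] by (simp add: mult_ac)
  qed
  have "target_list_sum (Suc d) x Js i0 ({1..n} - I0) = (\<Sum>ts\<in>?O.
      of_int (ambient_sign n d) * a ^ d * (if \<forall>v\<in>S. leaf hs v then of_int (root_sign I0 hs ts) *
             (\<Prod>i\<in>{..<Suc d} - {i0}. q ({1..n} - sources hs ts i)) else 0))"
    unfolding target_list_sum_def orientation_roots_iff[symmetric]
    using summand by (intro sum.cong) auto
  moreover have "(\<Sum>ts\<in>A. if P then f ts else 0) = (if P then sum f A else 0)"
    for P A and f :: "nat list \<Rightarrow> 'a" by simp
  ultimately show ?thesis by (simp only: sum_distrib_left[symmetric])
qed

end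

section \<open>Bases and kernels in coordinates\<close>

text \<open>
  Coefficients are attached to positions in the list, so a repeated vector already violates
  independence; this is how distinctness is accounted for.
\<close>
lemma ordered_basis_iff:
  fixes U :: "('i \<Rightarrow> 'k::field) set"
  shows "ordered_basis U bs \<longleftrightarrow>
     U = range (\<lambda>a. \<Sum>r<length bs. fscale (a r) (bs ! r)) \<and>
     (\<forall>a. (\<Sum>r<length bs. fscale (a r) (bs ! r)) = 0 \<longrightarrow> (\<forall>r<length bs. a r = 0))"
  (is "_ \<longleftrightarrow> U = range ?comb \<and> ?indep")
proof -
  have by_index: "(\<Sum>v\<in>set bs. fscale (u v) v) = ?comb (\<lambda>r. u (bs ! r))" if "distinct bs" for u
    using sum.reindex_bij_betw[OF bij_betw_nth[OF that refl refl], of "\<lambda>v. fscale (u v) v"] by simp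
  have by_vector: "\<exists>u. (\<forall>r<length bs. u (bs ! r) = a r)" if "distinct bs" for a :: "nat \<Rightarrow> 'k"
  proof (intro exI allI impI)
    fix r assume "r < length bs"
    then show "a (inv_into {..<length bs} ((!) bs) (bs ! r)) = a r"
      using that by (subst inv_into_f_f) (auto simp: inj_on_nth)
  qed
  have distinct: "distinct bs" if ?indep
    unfolding distinct_conv_nth
  proof (intro allI impI notI)
    fix i j assume ij: "i < length bs" "j < length bs" "i \<noteq> j" "bs ! i = bs ! j"
    let ?a = "\<lambda>r. if r = i then 1 else if r = j then -1 else 0 :: 'k"
    have "?comb ?a = (\<Sum>r\<in>{i, j}. fscale (?a r) (bs ! r))"
      using ij by (intro sum.mono_neutral_right) (auto simp: fscale_def fun_eq_iff)
    also have "\<dots> = 0" using ij by (simp add: fscale_def fun_eq_iff)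
    finally show False using that ij by (auto dest!: spec[of _ ?a])
  qed
  have span: "fs.span (set bs) = range ?comb" if d: "distinct bs"
  proof -
    have "range (\<lambda>u. ?comb (\<lambda>r. u (bs ! r))) = range ?comb"
    proof (intro subset_antisym image_subsetI)
      fix a :: "nat \<Rightarrow> 'k"
      obtain u where u: "\<forall>r<length bs. u (bs ! r) = a r" using by_vector[OF d] by blast
      have "?comb a = ?comb (\<lambda>r. u (bs ! r))" using u by (intro sum.cong) auto
      then show "?comb a \<in> range (\<lambda>u. ?comb (\<lambda>r. u (bs ! r)))" by blast
    next
      fix u
      show "?comb (\<lambda>r. u (bs ! r)) \<in> range ?comb" by (rule rangeI)
    qed
    then show ?thesis by (simp only: by_index[OF d] fs.span_finite[OF finite_set])
  qed
  have indep: "fs.independent (set bs) \<longleftrightarrow> ?indep" if d: "distinct bs"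
  proof -
    have "fs.independent (set bs) \<longleftrightarrow>
        (\<forall>u. (\<Sum>v\<in>set bs. fscale (u v) v) = 0 \<longrightarrow> (\<forall>v\<in>set bs. u v = 0))"
      unfolding fs.dependent_finite[OF finite_set] by blast
    also have "\<dots> \<longleftrightarrow> (\<forall>u. ?comb (\<lambda>r. u (bs ! r)) = 0 \<longrightarrow> (\<forall>r<length bs. u (bs ! r) = 0))"
      by (simp only: by_index[OF d] all_set_conv_all_nth)
    also have "\<dots> \<longleftrightarrow> ?indep"
    proof (intro iffI allI)
      fix a :: "nat \<Rightarrow> 'k" assume *: "\<forall>u. ?comb (\<lambda>r. u (bs ! r)) = 0 \<longrightarrow> (\<forall>r<length bs. u (bs ! r) = 0)"
      obtain u where u: "\<forall>r<length bs. u (bs ! r) = a r" using by_vector[OF d] by blast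
      have eq: "?comb a = ?comb (\<lambda>r. u (bs ! r))" using u by (intro sum.cong) auto
      show "?comb a = 0 \<longrightarrow> (\<forall>r<length bs. a r = 0)"
      proof (intro impI allI)
        fix r assume "?comb a = 0" "r < length bs"
        then have "u (bs ! r) = 0" using *[rule_format, of u r] unfolding eq by blast
        then show "a r = 0" using u \<open>r < length bs\<close> by simp
      qed
    qed auto
    finally show ?thesis .
  qed
  show ?thesis
    unfolding ordered_basis_def using distinct span indep by (cases "distinct bs") auto
qed

lemma ordered_basis_dim:
  assumes "ordered_basis U bs"
  shows "fs.subspace U" "fs.dim U = length bs"
  using assms fs.dim_eq_card_independent[of "set bs"]
  by (auto simp: ordered_basis_def distinct_card)

lemma sum_fscale_apply:
  "(\<Sum>r\<in>A. fscale (a r) (f r)) i = (\<Sum>r\<in>A. a r * f r i)"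
  by (induction A rule: infinite_finite_induct) (auto simp: fscale_def)

lemma row_kernel:
  fixes G :: "'a::field mat"
  assumes G: "G \<in> carrier_mat D D"
  shows "det G \<noteq> 0 \<longleftrightarrow>
     (\<forall>a. (\<forall>s<D. (\<Sum>r<D. a r * G $$ (r, s)) = 0) \<longrightarrow> (\<forall>r<D. a r = 0))"
proof -
  let ?H = "transpose_mat G"
  have eq: "?H *\<^sub>v v = 0\<^sub>v D \<longleftrightarrow> (\<forall>s<D. (\<Sum>r<D. v $ r * G $$ (r, s)) = 0)"
    if "v \<in> carrier_vec D" for v
  proof -
    have "(?H *\<^sub>v v) $ s = (\<Sum>r<D. v $ r * G $$ (r, s))" if "s < D" for s
      using that G \<open>v \<in> carrier_vec D\<close>
      by (auto simp: scalar_prod_def atLeast0LessThan mult.commute intro!: sum.cong)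
    moreover have "?H *\<^sub>v v = 0\<^sub>v D \<longleftrightarrow> (\<forall>s<D. (?H *\<^sub>v v) $ s = 0)"
      using G that by (auto simp: vec_eq_iff)
    ultimately show ?thesis by auto
  qed
  have "det G = 0 \<longleftrightarrow> (\<exists>v. v \<in> carrier_vec D \<and> v \<noteq> 0\<^sub>v D \<and> ?H *\<^sub>v v = 0\<^sub>v D)"
    using det_0_iff_vec_prod_zero_field[of ?H D] G by (simp add: det_transpose)
  also have "\<dots> \<longleftrightarrow>
     \<not> (\<forall>a. (\<forall>s<D. (\<Sum>r<D. a r * G $$ (r, s)) = 0) \<longrightarrow> (\<forall>r<D. a r = 0))"
    (is "?L \<longleftrightarrow> \<not> ?R")
  proof
    assume ?L
    then obtain v where v: "v \<in> carrier_vec D" "v \<noteq> 0\<^sub>v D" "?H *\<^sub>v v = 0\<^sub>v D" by blast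
    have "\<exists>r<D. v $ r \<noteq> 0"
    proof (rule ccontr)
      assume "\<not> (\<exists>r<D. v $ r \<noteq> 0)"
      then have "v = 0\<^sub>v D" using v(1) by auto
      then show False using v(2) by blast
    qed
    then show "\<not> ?R" using v eq by blast
  next
    assume "\<not> ?R"
    then obtain a r where a: "\<forall>s<D. (\<Sum>r<D. a r * G $$ (r, s)) = 0" "r < D" "a r \<noteq> 0"
      by blast
    have "vec D a \<noteq> 0\<^sub>v D" using a by (auto dest!: arg_cong[of _ _ "\<lambda>v. v $ r"])
    moreover have "?H *\<^sub>v vec D a = 0\<^sub>v D" using a eq[of "vec D a"] by simp
    ultimately show ?L by (intro exI[of _ "vec D a"]) auto
  qed
  finally show ?thesis by blast
qed

lemma column_kernel:
  fixes G :: "'a::field mat"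
  assumes G: "G \<in> carrier_mat D D"
  shows "det G \<noteq> 0 \<longleftrightarrow>
     (\<forall>a. (\<forall>r<D. (\<Sum>s<D. G $$ (r, s) * a s) = 0) \<longrightarrow> (\<forall>s<D. a s = 0))"
  using row_kernel[of "transpose_mat G" D] G
  by (simp add: det_transpose mult.commute cong: sum.cong_simp)

lemma bordered_scale: "D > 0 \<Longrightarrow> bordered D x (\<lambda>r. c * u r) J = c * bordered D x u J"
  by (simp add: bordered_expand sum_distrib_left mult.assoc)

lemma bordered_cong:
  "(\<And>r. r < D \<Longrightarrow> u r = v r) \<Longrightarrow> bordered D x u J = bordered D x v J"
  unfolding bordered_def by (intro arg_cong[of _ _ det] eq_matI) auto

section \<open>Hyperplanes and their normal vectors\<close>

text \<open>
  The rows of \<open>G\<close> after the first are orthogonal to \<open>w\<close>, so \<open>w\<close> is a normal vector of the hyperplane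
  spanned by the combinations \<open>b\<close> of the rows of \<open>x\<close>.  Multiplying the bordered matrix \<open>[w | x\<^sub>J]\<close>
  by \<open>G\<close> turns its border into the first unit vector and leaves the minor of \<open>b\<close> as its cofactor.
\<close>
lemma minors_of_hyperplane:
  fixes x :: "nat \<Rightarrow> nat \<Rightarrow> 'a::comm_ring_1"
  assumes G: "G \<in> carrier_mat (Suc d) (Suc d)"
    and Gw: "\<And>i. i < Suc d \<Longrightarrow> (\<Sum>r<Suc d. G $$ (i, r) * w r) = (if i = 0 then 1 else 0)"
    and b: "\<And>k i. k < d \<Longrightarrow> b k i = (\<Sum>r<Suc d. G $$ (Suc k, r) * x r i)"
  shows "det (mat d d (\<lambda>(k, c). b k (sorted_list_of_set J ! c)))
       = bordered (Suc d) x (\<lambda>r. det G * w r) J"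
proof -
  let ?M = "mat (Suc d) (Suc d) (\<lambda>(r, c). if c = 0 then w r else x r (sorted_list_of_set J ! (c - 1)))"
  have prod: "(G * ?M) $$ (i, c) = (\<Sum>r<Suc d. G $$ (i, r) *
      (if c = 0 then w r else x r (sorted_list_of_set J ! (c - 1))))"
    if "i < Suc d" "c < Suc d" for i c
    using that G
    by (simp add: scalar_prod_def atLeast0LessThan del: sum.lessThan_Suc cong: sum.cong_simp)
  have "det (G * ?M) = (\<Sum>i<Suc d. (if i = 0 then 1 else 0) * cofactor (G * ?M) i 0)"
    using G Gw
    by (subst laplace_expansion_column[of _ "Suc d" 0])
       (auto simp: prod simp del: sum.lessThan_Suc index_mult_mat(1) intro!: sum.cong)
  also have "\<dots> = det (mat_delete (G * ?M) 0 0)"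
    by (simp add: if_distrib[of "\<lambda>a. a * _"] cofactor_def del: sum.lessThan_Suc cong: if_cong)
  also have "mat_delete (G * ?M) 0 0
      = mat d d (\<lambda>(k, c). b k (sorted_list_of_set J ! c))"
    using G prod b
    by (intro eq_matI) (auto simp: mat_delete_def simp del: sum.lessThan_Suc index_mult_mat(1))
  finally have "det (mat d d (\<lambda>(k, c). b k (sorted_list_of_set J ! c)))
      = det G * bordered (Suc d) x w J"
    using G by (simp add: det_mult[of _ "Suc d"] bordered_def)
  then show ?thesis by (simp only: bordered_scale[OF zero_less_Suc])
qed

text \<open>
  Every nonzero vector is the normal of some hyperplane, with a basis scaled such that no factor
  remains in \<open>minors_of_hyperplane\<close>.
\<close>
lemma hyperplane_with_normal:
  fixes u :: "nat \<Rightarrow> 'a::field"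
  assumes "d \<ge> 1" "r0 < Suc d" "u r0 \<noteq> 0"
  obtains G where "G \<in> carrier_mat (Suc d) (Suc d)" "det G = 1"
    "\<And>i. i < Suc d \<Longrightarrow> (\<Sum>r<Suc d. G $$ (i, r) * u r) = (if i = 0 then 1 else 0)"
proof -
  let ?\<tau> = "transpose 0 r0"
  let ?e = "\<lambda>i r. if r = i then 1 else 0 :: 'a"
  \<comment> \<open>Rows: a multiple of the unit vector \<open>e\<^sub>r\<^sub>0\<close> that pairs to \<open>1\<close> with \<open>u\<close>, then the unit vectors
    other than \<open>e\<^sub>r\<^sub>0\<close>, made orthogonal to \<open>u\<close> by means of \<open>e\<^sub>r\<^sub>0\<close>.\<close>
  define H where "H = mat (Suc d) (Suc d) (\<lambda>(i, r).
    if i = 0 then ?e r0 r / u r0 else ?e (?\<tau> i) r - u (?\<tau> i) / u r0 * ?e r0 r)"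
  have H: "H \<in> carrier_mat (Suc d) (Suc d)" by (simp add: H_def)
  have \<tau>: "?\<tau> i < Suc d" if "i < Suc d" for i using that assms by (auto simp: transpose_def)
  have sum_e: "(\<Sum>r<Suc d. ?e i r * v r) = v i" if "i < Suc d" for i v
    using that by (simp add: if_distrib[of "\<lambda>a. a * _"] del: sum.lessThan_Suc cong: if_cong)
  have Hv: "(\<Sum>r<Suc d. H $$ (i, r) * v r) =
      (if i = 0 then v r0 / u r0 else v (?\<tau> i) - u (?\<tau> i) / u r0 * v r0)" if i: "i < Suc d" for i v
  proof (cases "i = 0")
    case True
    have "(\<Sum>r<Suc d. H $$ (i, r) * v r) = (\<Sum>r<Suc d. ?e r0 r * (v r / u r0))"
      using True by (intro sum.cong) (auto simp: H_def)
    then show ?thesis using True sum_e[OF assms(2), of "\<lambda>r. v r / u r0"] by simp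
  next
    case False
    have "(\<Sum>r<Suc d. H $$ (i, r) * v r)
        = (\<Sum>r<Suc d. ?e (?\<tau> i) r * v r - ?e r0 r * (u (?\<tau> i) / u r0 * v r))"
      using False i by (intro sum.cong) (auto simp: H_def algebra_simps)
    then show ?thesis
      using False sum_e[OF assms(2), of "\<lambda>r. u (?\<tau> i) / u r0 * v r"] sum_e[OF \<tau>[OF i], of v]
      by (simp only: sum_subtractf if_False)
  qed
  have "det H \<noteq> 0"
    unfolding column_kernel[OF H]
  proof (intro allI impI)
    fix v s assume v: "\<forall>i<Suc d. (\<Sum>r<Suc d. H $$ (i, r) * v r) = 0" and s: "s < Suc d"
    have r0: "v r0 = 0" using v[rule_format, of 0] Hv[of 0 v] assms by simp
    show "v s = 0"
    proof (cases "s = r0")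
      case False
      then have "?\<tau> s \<noteq> 0" by (auto simp: transpose_def split: if_splits)
      then show ?thesis using v[rule_format, OF \<tau>[OF s]] Hv[OF \<tau>[OF s], of v] r0 by simp
    qed (use r0 in simp)
  qed
  \<comment> \<open>Row \<open>1\<close> exists as \<open>d \<ge> 1\<close>, and scaling it preserves orthogonality to \<open>u\<close>.\<close>
  define G where "G = multrow 1 (inverse (det H)) H"
  have "det G = 1" using \<open>det H \<noteq> 0\<close> assms(1) H by (simp add: G_def det_multrow[of _ "Suc d"])
  moreover have "G \<in> carrier_mat (Suc d) (Suc d)" using H by (simp add: G_def)
  moreover have "(\<Sum>r<Suc d. G $$ (i, r) * u r) = (if i = 0 then 1 else 0)" if i: "i < Suc d" for i
  proof -
    have "(\<Sum>r<Suc d. G $$ (i, r) * u r)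
        = (if i = 1 then inverse (det H) else 1) * (\<Sum>r<Suc d. H $$ (i, r) * u r)"
      unfolding sum_distrib_left using H i by (intro sum.cong) (auto simp: G_def)
    then show ?thesis using Hv[OF i, of u] assms(3) by simp
  qed
  ultimately show thesis using that by blast
qed

section \<open>The ambient space of the hyperplanes\<close>

text \<open>
  Since the minor on \<open>C\<close> is invertible, the basis can be normalized to be the identity on the columns
  \<open>C\<close>.  Then the coordinates of a vector are just its entries at \<open>C\<close>.
\<close>
lemma echelon_basis:
  fixes X :: "(nat \<Rightarrow> 'k::field) set"
  assumes X: "plucker_coords (<) {1..n} X q" "fs.dim X = D"
    and C: "C \<in> nsets {1..n} D" "q C \<noteq> 0"
  obtains y where
    "\<And>r k. r < D \<Longrightarrow> k < D \<Longrightarrow> y r (sorted_list_of_set C ! k) = (if r = k then 1 else 0)"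
    "\<And>r. r < D \<Longrightarrow> y r \<in> X"
    "\<And>v i. v \<in> X \<Longrightarrow> v i = (\<Sum>r<D. v (sorted_list_of_set C ! r) * y r i)"
    "\<And>I. I \<in> nsets {1..n} D \<Longrightarrow> sorted_minor D y I = inverse (q C) * q I"
proof -
  let ?C = "sorted_list_of_set C"
  obtain bs where bs: "ordered_basis X bs"
    and q: "\<And>xs. sorted_wrt (<) xs \<Longrightarrow> set xs \<subseteq> {1..n} \<Longrightarrow> length xs = length bs \<Longrightarrow>
           q (set xs) = det (mat (length bs) (length bs) (\<lambda>(r, c). (bs ! r) (xs ! c)))"
    using X(1) unfolding plucker_coords_def by blast
  have len: "length bs = D" using ordered_basis_dim[OF bs] X(2) by simp
  have q_minor: "q I = sorted_minor D ((!) bs) I" if "I \<in> nsets {1..n} D" for I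
    using q[of "sorted_list_of_set I"] that len
    by (auto simp: sorted_minor_def minor_def nsets_def)
  define B where "B = mat D D (\<lambda>(r, c). (bs ! r) (?C ! c))"
  have detB: "det B = q C" using q_minor[OF C(1)] by (simp add: B_def sorted_minor_def minor_def)
  have B: "B \<in> carrier_mat D D" by (simp add: B_def)
  define A where "A = inverse (q C) \<cdot>\<^sub>m adj_mat B"
  have A: "A \<in> carrier_mat D D" using adj_mat(1)[OF B] by (simp add: A_def)
  have AB: "A * B = 1\<^sub>m D" and BA: "B * A = 1\<^sub>m D"
    using adj_mat[OF B] C(2) detB
    by (auto simp: A_def mult_smult_assoc_mat[OF _ B] mult_smult_distrib[OF B] intro!: eq_matI)
  have entry: "(\<Sum>k<D. M $$ (i, k) * N $$ (k, j)) = (M * N) $$ (i, j)"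
    if "M \<in> carrier_mat D D" "N \<in> carrier_mat D D" "i < D" "j < D" for M N :: "'k mat" and i j
    using that by (simp add: scalar_prod_def atLeast0LessThan)
  define y where "y r = (\<Sum>k<D. fscale (A $$ (r, k)) (bs ! k))" for r
  have y: "y r i = (\<Sum>k<D. A $$ (r, k) * (bs ! k) i)" for r i
    by (simp add: y_def sum_fscale_apply)
  have "y r (?C ! k) = (if r = k then 1 else 0)" if "r < D" "k < D" for r k
  proof -
    have "y r (?C ! k) = (\<Sum>l<D. A $$ (r, l) * B $$ (l, k))"
      unfolding y using that by (intro sum.cong) (auto simp: B_def)
    then show ?thesis using that entry[OF A B that] AB by simp
  qed
  moreover have "y r \<in> X" for r
    using bs len by (auto simp: ordered_basis_iff y_def)
  moreover have "v i = (\<Sum>r<D. v (?C ! r) * y r i)" if v: "v \<in> X" for v i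
  proof -
    obtain a where "v = (\<Sum>k<D. fscale (a k) (bs ! k))"
      using v bs len by (auto simp: ordered_basis_iff)
    then have a: "v j = (\<Sum>k<D. a k * (bs ! k) j)" for j by (simp add: sum_fscale_apply)
    have "(\<Sum>r<D. v (?C ! r) * y r i)
        = (\<Sum>r<D. (\<Sum>k<D. a k * B $$ (k, r)) * (\<Sum>l<D. A $$ (r, l) * (bs ! l) i))"
      unfolding a y by (intro sum.cong arg_cong2[of _ _ _ _ "(*)"]) (auto simp: B_def)
    also have "\<dots> = (\<Sum>r<D. \<Sum>k<D. \<Sum>l<D. a k * (B $$ (k, r) * A $$ (r, l)) * (bs ! l) i)"
      unfolding sum_product by (intro sum.cong refl) (simp only: mult.assoc)
    also have "\<dots> = (\<Sum>k<D. \<Sum>l<D. \<Sum>r<D. a k * (B $$ (k, r) * A $$ (r, l)) * (bs ! l) i)"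
      by (subst sum.swap) (intro sum.cong refl sum.swap)
    also have "\<dots> = (\<Sum>k<D. \<Sum>l<D. a k * (1\<^sub>m D $$ (k, l)) * (bs ! l) i)"
    proof (intro sum.cong refl)
      fix k l assume "k \<in> {..<D}" "l \<in> {..<D}"
      then show "(\<Sum>r<D. a k * (B $$ (k, r) * A $$ (r, l)) * (bs ! l) i)
          = a k * (1\<^sub>m D $$ (k, l)) * (bs ! l) i"
        using entry[OF B A, of k l] BA by (simp flip: sum_distrib_left sum_distrib_right)
    qed
    also have "\<dots> = (\<Sum>k<D. \<Sum>l<D. if k = l then a k * (bs ! l) i else 0)"
      by (intro sum.cong) auto
    also have "\<dots> = v i" unfolding a by (intro sum.cong) auto
    finally show ?thesis by simp
  qed
  moreover have "sorted_minor D y I = inverse (q C) * q I" if I: "I \<in> nsets {1..n} D" for I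
  proof -
    let ?M = "mat D D (\<lambda>(r, c). (bs ! r) (sorted_list_of_set I ! c))"
    have "mat D D (\<lambda>(r, c). y r (sorted_list_of_set I ! c)) = A * ?M"
      using A by (intro eq_matI) (auto simp: y scalar_prod_def atLeast0LessThan intro!: sum.cong)
    then have "sorted_minor D y I = det A * q I"
      using A q_minor[OF I] by (simp add: sorted_minor_def minor_def det_mult[of _ D])
    moreover have "det A * q C = 1"
      using det_mult[OF A B] AB detB by simp
    ultimately show ?thesis using C(2) by (simp add: field_simps)
  qed
  ultimately show thesis using that[of y] by blast
qed

text \<open>
  A basis of \<open>{v. coord_pr S v \<in> X}\<close>, obtained from a basis \<open>y\<close> of \<open>X\<close> that is the identity on the
  columns \<open>cs\<close>: the rows with pivot in \<open>S\<close> become unit vectors, and the others vanish on \<open>S\<close>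
  already.
\<close>
definition adapted_basis :: "(nat \<Rightarrow> nat \<Rightarrow> 'k::field) \<Rightarrow> nat set \<Rightarrow> nat list \<Rightarrow> nat \<Rightarrow> nat \<Rightarrow> 'k" where
  "adapted_basis y S cs r = (if cs ! r \<in> S then (\<lambda>i. if i = cs ! r then 1 else 0) else y r)"

lemma adapted_basis_echelon:
  assumes "distinct cs" "length cs = D"
    and "\<And>r k. r < D \<Longrightarrow> k < D \<Longrightarrow> y r (cs ! k) = (if r = k then 1 else 0)"
    and "r < D" "k < D"
  shows "adapted_basis y S cs r (cs ! k) = (if r = k then 1 else 0)"
  using assms by (auto simp: adapted_basis_def nth_eq_iff_index_eq)

text \<open>
  In both matrices a column in \<open>S\<close> is a unit vector.  A nonzero Leibniz summand of either therefore
  assigns the column \<open>cs ! r \<in> S\<close> to the row \<open>r\<close>, and on such summands the two matrices agree, because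
  they differ only in rows with pivot in \<open>S\<close>.  If \<open>I\<close> misses an element of \<open>S\<close>, the adapted matrix has
  a zero row.
\<close>
lemma sorted_minor_adapted:
  assumes cs: "distinct cs" "length cs = D" "S \<subseteq> set cs"
    and y: "\<And>r k. r < D \<Longrightarrow> k < D \<Longrightarrow> y r (cs ! k) = (if r = k then 1 else 0)"
    and I: "finite I" "card I = D"
  shows "sorted_minor D (adapted_basis y S cs) I = (if S \<subseteq> I then sorted_minor D y I else 0)"
proof -
  let ?I = "sorted_list_of_set I"
  let ?x = "adapted_basis y S cs"
  have leib: "sorted_minor D z I = (\<Sum>ts \<in> permutations_of_set I.
      of_int (target_sign ts) * (\<Prod>i<D. z i (ts ! i)))" for z :: "nat \<Rightarrow> nat \<Rightarrow> 'a"
    unfolding sorted_minor_def using minor_leibniz[of ?I D z] I by simp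
  have products: "(\<Prod>i<D. ?x i (ts ! i)) = (if S \<subseteq> I then (\<Prod>i<D. y i (ts ! i)) else 0)"
    if ts: "ts \<in> permutations_of_set I" for ts
  proof -
    have set_ts: "set ts = I" "distinct ts" using ts by (auto simp: permutations_of_set_def)
    have len: "length ts = D" using set_ts I by (metis distinct_card)
    show ?thesis
    proof (cases "\<forall>r<D. cs ! r \<in> S \<longrightarrow> ts ! r = cs ! r")
      case True
      have "S \<subseteq> I"
      proof
        fix s assume "s \<in> S"
        then obtain r where "r < D" "s = cs ! r" using cs by (metis in_set_conv_nth subsetD)
        then show "s \<in> I" using True \<open>s \<in> S\<close> set_ts len by (metis nth_mem)
      qed
      moreover have "?x i (ts ! i) = y i (ts ! i)" if "i < D" for i
        using True that y[of i i] by (auto simp: adapted_basis_def)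
      ultimately show ?thesis by simp
    next
      case False
      then obtain r where r: "r < D" "cs ! r \<in> S" "ts ! r \<noteq> cs ! r" by blast
      then have "(\<Prod>i<D. ?x i (ts ! i)) = 0"
        by (intro prod_zero bexI[of _ r]) (auto simp: adapted_basis_def)
      moreover have "(\<Prod>i<D. y i (ts ! i)) = 0" if "S \<subseteq> I"
      proof -
        have "cs ! r \<in> set ts" using that r set_ts by auto
        then obtain k where k: "k < D" "ts ! k = cs ! r"
          unfolding in_set_conv_nth len by blast
        then have "y k (ts ! k) = 0" using r y[of k r] by auto
        then show ?thesis using k by (intro prod_zero bexI[of _ k]) auto
      qed
      ultimately show ?thesis by presburger
    qed
  qed
  show ?thesis by (simp add: leib products cong: sum.cong_simp)
qed

text \<open>
  The space \<open>{v. coord_pr S v \<in> X}\<close> is the span of the adapted basis: the unit vectors reproduce the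
  part of \<open>v\<close> supported on \<open>S\<close>, and the remaining rows reproduce \<open>coord_pr S v\<close> within \<open>X\<close>.
\<close>
lemma coord_pr_mem_iff:
  fixes X :: "(nat \<Rightarrow> 'k::field) set"
  assumes X: "fs.subspace X"
    and cs: "distinct cs" "length cs = D" "S \<subseteq> set cs"
    and y: "\<And>r k. r < D \<Longrightarrow> k < D \<Longrightarrow> y r (cs ! k) = (if r = k then 1 else 0)"
    and yX: "\<And>r. r < D \<Longrightarrow> y r \<in> X"
    and coords: "\<And>v i. v \<in> X \<Longrightarrow> v i = (\<Sum>r<D. v (cs ! r) * y r i)"
  shows "coord_pr S v \<in> X \<longleftrightarrow> (\<forall>i. v i = (\<Sum>r<D. v (cs ! r) * adapted_basis y S cs r i))"
proof -
  let ?x = "adapted_basis y S cs"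
  have S_part: "(\<Sum>r<D. if cs ! r \<in> S then v (cs ! r) * ?x r i else 0) = (if i \<in> S then v i else 0)" for i
  proof -
    have "(\<Sum>r<D. if cs ! r \<in> S then v (cs ! r) * ?x r i else 0)
        = (\<Sum>r<D. (\<lambda>s. if s = i then (if i \<in> S then v i else 0) else 0) (cs ! r))"
      by (intro sum.cong) (auto simp: adapted_basis_def)
    also have "\<dots> = (\<Sum>s\<in>set cs. if s = i then (if i \<in> S then v i else 0) else 0)"
      by (rule sum.reindex_bij_betw) (use bij_betw_nth[OF cs(1) refl refl] cs(2) in simp)
    also have "\<dots> = (if i \<in> S then v i else 0)" using cs(3) by auto
    finally show ?thesis .
  qed
  have split: "(\<Sum>r<D. v (cs ! r) * ?x r i)
      = (if i \<in> S then v i else 0) + (\<Sum>r<D. coord_pr S v (cs ! r) * y r i)" for i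
    unfolding S_part[symmetric] sum.distrib[symmetric]
    by (intro sum.cong) (auto simp: adapted_basis_def coord_pr_def)
  have "(\<forall>i. v i = (\<Sum>r<D. v (cs ! r) * ?x r i))
      \<longleftrightarrow> (\<forall>i. coord_pr S v i = (\<Sum>r<D. coord_pr S v (cs ! r) * y r i))"
    unfolding split
  proof (rule all_cong1)
    fix i
    have "v i = (if i \<in> S then v i else 0) + coord_pr S v i" by (simp add: coord_pr_def)
    then show "(v i = (if i \<in> S then v i else 0) + (\<Sum>r<D. coord_pr S v (cs ! r) * y r i))
      \<longleftrightarrow> (coord_pr S v i = (\<Sum>r<D. coord_pr S v (cs ! r) * y r i))"
      by (metis add_left_cancel)
  qed
  also have "\<dots> \<longleftrightarrow> coord_pr S v \<in> X"
  proof
    assume *: "\<forall>i. coord_pr S v i = (\<Sum>r<D. coord_pr S v (cs ! r) * y r i)"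
    have "coord_pr S v = (\<Sum>r<D. fscale (coord_pr S v (cs ! r)) (y r))"
      by (rule ext) (simp only: sum_fscale_apply *[rule_format, symmetric])
    then show "coord_pr S v \<in> X"
      by (metis (no_types, lifting) X yX fs.subspace_scale fs.subspace_sum lessThan_iff)
  qed (use coords in blast)
  finally show ?thesis by blast
qed

section \<open>The cone over the hyperplanes of a space\<close>

definition cone_coords ::
  "nat \<Rightarrow> nat \<Rightarrow> (nat \<Rightarrow> nat \<Rightarrow> 'k::field) \<Rightarrow> (nat \<Rightarrow> 'k) \<Rightarrow> nat set \<Rightarrow> 'k" where
  "cone_coords n d x u = (\<lambda>J. if J \<in> nsets {1..n} d then bordered (Suc d) x u J else 0)"

definition cone_basis ::
  "nat \<Rightarrow> nat \<Rightarrow> (nat \<Rightarrow> nat \<Rightarrow> 'k::field) \<Rightarrow> nat \<Rightarrow> nat set \<Rightarrow> 'k" where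
  "cone_basis n d x r = (\<lambda>J. if J \<in> nsets {1..n} d then border_cofactor (Suc d) x r J else 0)"

lemma plucker_coords_determined:
  assumes "plucker_coords (<) {1..n} Y p" "fs.dim Y = d"
  obtains bs where "ordered_basis Y bs" "length bs = d"
    "p = (\<lambda>J. if J \<in> nsets {1..n} d
            then det (mat d d (\<lambda>(k, c). (bs ! k) (sorted_list_of_set J ! c))) else 0)"
proof -
  obtain bs where bs: "ordered_basis Y bs" and p0: "p \<in> coord_space (nsets {1..n} (length bs))"
    and p: "\<And>xs. sorted_wrt (<) xs \<Longrightarrow> set xs \<subseteq> {1..n} \<Longrightarrow> length xs = length bs \<Longrightarrow>
           p (set xs) = det (mat (length bs) (length bs) (\<lambda>(r, c). (bs ! r) (xs ! c)))"
    using assms(1) unfolding plucker_coords_def by blast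
  have len: "length bs = d" using ordered_basis_dim[OF bs] assms(2) by simp
  have "p J = det (mat d d (\<lambda>(k, c). (bs ! k) (sorted_list_of_set J ! c)))"
    if "J \<in> nsets {1..n} d" for J
    using p[of "sorted_list_of_set J"] that len by (auto simp: nsets_def)
  moreover have "p J = 0" if "J \<notin> nsets {1..n} d" for J
    using p0 that len by (auto simp: coord_space_def)
  ultimately have "p = (\<lambda>J. if J \<in> nsets {1..n} d
            then det (mat d d (\<lambda>(k, c). (bs ! k) (sorted_list_of_set J ! c))) else 0)"
    by (intro ext) simp
  then show thesis by (rule that[OF bs len])
qed

lemma plucker_coords_hyperplane:
  assumes bs: "ordered_basis Y bs" "length bs = d"
    and det: "\<And>J. det (mat d d (\<lambda>(k, c). (bs ! k) (sorted_list_of_set J ! c)))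
      = bordered (Suc d) x u J"
  shows "plucker_coords (<) {1..n} Y (cone_coords n d x u)"
  unfolding plucker_coords_def
proof (intro exI conjI allI impI)
  show "ordered_basis Y bs" by fact
  show "cone_coords n d x u \<in> coord_space (nsets {1..n} (length bs))"
    using bs by (simp add: coord_space_def cone_coords_def)
  fix xs :: "nat list" assume xs: "sorted_wrt (<) xs \<and> set xs \<subseteq> {1..n} \<and> length xs = length bs"
  then have "distinct xs" "sorted xs" by (auto simp: strict_sorted_iff)
  then have "sorted_list_of_set (set xs) = xs" "set xs \<in> nsets {1..n} d"
    using xs bs by (auto simp: nsets_def distinct_card sorted_list_of_set_sort_remdups
        distinct_remdups_id sorted_sort_id)
  then show "cone_coords n d x u (set xs)
      = det (mat (length bs) (length bs) (\<lambda>(r, c). (bs ! r) (xs ! c)))"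
    using det[of "set xs"] bs by (simp add: cone_coords_def)
qed

lemma cone_coords_eq_sum:
  "cone_coords n d x u = (\<Sum>r<Suc d. fscale (u r) (cone_basis n d x r))"
proof (rule ext)
  fix J
  show "cone_coords n d x u J = (\<Sum>r<Suc d. fscale (u r) (cone_basis n d x r)) J"
    by (cases "J \<in> nsets {1..n} d")
       (simp_all add: cone_coords_def cone_basis_def sum_fscale_apply bordered_expand
         del: sum.lessThan_Suc)
qed

text \<open>
  The rows of \<open>x\<close> form an echelon basis: they are the identity on the columns \<open>cs\<close>, so a vector
  \<open>v\<close> in their span has the coefficients \<open>v (cs ! r)\<close>.
\<close>

context
  fixes n d :: nat and x :: "nat \<Rightarrow> nat \<Rightarrow> 'k::field" and cs :: "nat list"
  assumes d: "1 \<le> d"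
    and cs: "sorted cs" "distinct cs" "length cs = Suc d" "set cs \<subseteq> {1..n}"
    and echelon: "\<And>r k. r < Suc d \<Longrightarrow> k < Suc d \<Longrightarrow> x r (cs ! k) = (if r = k then 1 else 0)"
    and supp: "\<And>r i. r < Suc d \<Longrightarrow> i \<notin> {1..n} \<Longrightarrow> x r i = 0"
begin

text \<open>
  The entries of \<open>u\<close> can be read off from the coordinates of its hyperplane at the \<open>d\<close>-subsets of the
  pivots, where the bordered matrix is, up to the order of its columns, the identity with one column
  replaced by \<open>u\<close>.  This gives the
  independence of the \<open>d + 1\<close> generators of the cone.
\<close>
lemma cone_coords_determine:
  assumes r: "r < Suc d"
  shows "cone_coords n d x u (set cs - {cs ! r})
    = (-1) ^ card {j \<in> set cs - {cs ! r}. j < cs ! r} * u r"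
proof -
  let ?J = "set cs - {cs ! r}"
  have J: "finite ?J" "Suc (card ?J) = Suc d" "?J \<in> nsets {1..n} d"
    using cs r by (auto simp: nsets_def distinct_card)
  have "sorted_minor (Suc d) x (set cs) = det (1\<^sub>m (Suc d))"
    unfolding sorted_minor_def minor_def
    using echelon cs
    by (intro arg_cong[of _ _ det] eq_matI)
       (auto simp: sorted_list_of_set.idem_if_sorted_distinct)
  then have one: "sorted_minor (Suc d) x (set cs) = 1" by simp
  have at_J: "border_cofactor (Suc d) x k ?J
      = (if k = r then (-1) ^ card {j \<in> ?J. j < cs ! r} else 0)" if k: "k < Suc d" for k
  proof -
    have "border_cofactor (Suc d) x k ?J = bordered (Suc d) x (\<lambda>i. x i (cs ! k)) ?J"
      unfolding border_cofactor_def using echelon k by (intro bordered_cong) auto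
    also have "\<dots> = (if k = r then (-1) ^ card {j \<in> ?J. j < cs ! r} else 0)"
    proof (cases "k = r")
      case True
      have "insert (cs ! r) ?J = set cs" using r cs by auto
      then show ?thesis
        using True one bordered_column_notin[OF J(1,2), of "cs ! r" x] by simp
    next
      case False
      have "cs ! k \<noteq> cs ! r"
        using False k r cs by (simp add: nth_eq_iff_index_eq)
      then show ?thesis
        using False bordered_column_in[OF J(1,2), of "cs ! k" x] k cs by simp
    qed
    finally show ?thesis .
  qed
  have "cone_coords n d x u ?J = (\<Sum>k<Suc d. u k * border_cofactor (Suc d) x k ?J)"
    using J(3) by (simp only: cone_coords_def bordered_expand[OF zero_less_Suc] if_True)
  also have "\<dots> = (\<Sum>k<Suc d. if k = r then u k * (-1) ^ card {j \<in> ?J. j < cs ! r} else 0)"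
    using at_J by (intro sum.cong) auto
  also have "\<dots> = u r * (-1) ^ card {j \<in> ?J. j < cs ! r}"
    using r by (simp del: sum.lessThan_Suc)
  finally show ?thesis by (simp add: mult.commute)
qed

lemma ordered_basis_cone:
  "ordered_basis (range (cone_coords n d x)) (map (cone_basis n d x) [0..<Suc d])"
proof -
  have comb: "(\<Sum>r<length (map (cone_basis n d x) [0..<Suc d]).
      fscale (a r) (map (cone_basis n d x) [0..<Suc d] ! r)) = cone_coords n d x a" for a
    unfolding cone_coords_eq_sum
    by (intro sum.cong) (auto simp del: upt_Suc)
  have "a r = 0" if "cone_coords n d x a = 0" "r < Suc d" for a r
    using cone_coords_determine[OF that(2), of a] that(1) by simp
  then show ?thesis
    unfolding ordered_basis_iff comb by (auto simp del: upt_Suc)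
qed

text \<open>
  A subspace of dimension \<open>d\<close> has a normal vector \<open>w\<close>, because \<open>d\<close> rows of length \<open>d + 1\<close> have a
  common kernel vector; so its Pluecker coordinates are a multiple of those belonging to \<open>w\<close>.
  Conversely a hyperplane with normal vector \<open>u\<close> realizes the coordinates belonging to \<open>u\<close>.
\<close>
lemma cone_eq:
  assumes L: "L = {Y \<in> Gr d n. \<forall>v\<in>Y. \<forall>i. v i = (\<Sum>r<Suc d. v (cs ! r) * x r i)}"
  shows "plucker_cone n L = range (cone_coords n d x)"
proof
  have zero: "cone_coords n d x (\<lambda>_. 0) = 0"
    by (simp add: cone_coords_eq_sum fscale_def fun_eq_iff del: sum.lessThan_Suc)
  show "plucker_cone n L \<subseteq> range (cone_coords n d x)"
    unfolding plucker_cone_def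
  proof (intro insert_subsetI subsetI)
    show "0 \<in> range (cone_coords n d x)" using zero by (metis rangeI)
    fix p assume "p \<in> {p. \<exists>Y\<in>L. plucker_coords (<) {1..n} Y p}"
    then obtain Y where Y: "Y \<in> L" "plucker_coords (<) {1..n} Y p" by blast
    then have "fs.dim Y = d" by (simp add: L Gr_def)
    then obtain bs where bs: "ordered_basis Y bs" "length bs = d"
      and p: "p = (\<lambda>J. if J \<in> nsets {1..n} d
            then det (mat d d (\<lambda>(k, c). (bs ! k) (sorted_list_of_set J ! c))) else 0)"
      using plucker_coords_determined[OF Y(2)] by blast
    have bs_Y: "bs ! k \<in> Y" if "k < d" for k
      using bs that unfolding ordered_basis_def by (metis fs.span_base nth_mem)
    let ?B = "\<lambda>g. mat (Suc d) (Suc d) (\<lambda>(i, r). if i = 0 then g r else (bs ! (i - 1)) (cs ! r))"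
    \<comment> \<open>The coefficients of \<open>bs\<close>, below a row \<open>g\<close>.  For \<open>g = 0\<close> the matrix is singular, which yields
      the normal vector \<open>w\<close>; then \<open>g\<close> is replaced by a row that pairs to \<open>1\<close> with \<open>w\<close>.\<close>
    have "\<not> det (?B (\<lambda>_. 0)) \<noteq> 0"
      unfolding row_kernel[OF mat_carrier]
    proof
      assume *: "\<forall>a. (\<forall>s<Suc d. (\<Sum>r<Suc d. a r * ?B (\<lambda>_. 0) $$ (r, s)) = 0) \<longrightarrow>
        (\<forall>r<Suc d. a r = 0)"
      let ?e = "\<lambda>i :: nat. if i = 0 then 1 else 0 :: 'k"
      have "(\<Sum>r<Suc d. ?e r * ?B (\<lambda>_. 0) $$ (r, s)) = 0" if "s < Suc d" for s
        using that by (intro sum.neutral) auto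
      with *[rule_format, of ?e 0] show False by simp
    qed
    then have "\<not> (\<forall>a. (\<forall>i<Suc d. (\<Sum>r<Suc d. ?B (\<lambda>_. 0) $$ (i, r) * a r) = 0) \<longrightarrow>
        (\<forall>r<Suc d. a r = 0))"
      unfolding column_kernel[OF mat_carrier] .
    then obtain w r0 where w: "\<And>i. i < Suc d \<Longrightarrow> (\<Sum>r<Suc d. ?B (\<lambda>_. 0) $$ (i, r) * w r) = 0"
      "r0 < Suc d" "w r0 \<noteq> 0"
      by blast
    define G where "G = ?B (\<lambda>r. if r = r0 then inverse (w r0) else 0)"
    have G: "G \<in> carrier_mat (Suc d) (Suc d)" by (simp add: G_def)
    have Gw: "(\<Sum>r<Suc d. G $$ (i, r) * w r) = (if i = 0 then 1 else 0)" if i: "i < Suc d" for i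
    proof (cases "i = 0")
      case True
      have "(\<Sum>r<Suc d. G $$ (i, r) * w r)
          = (\<Sum>r<Suc d. if r = r0 then inverse (w r0) * w r else 0)"
        using True by (intro sum.cong) (auto simp: G_def)
      then show ?thesis using True w by (simp del: sum.lessThan_Suc)
    next
      case False
      have "(\<Sum>r<Suc d. G $$ (i, r) * w r) = (\<Sum>r<Suc d. ?B (\<lambda>_. 0) $$ (i, r) * w r)"
        using False i by (intro sum.cong) (auto simp: G_def)
      then show ?thesis using False w(1)[OF i] by simp
    qed
    have "(bs ! k) i = (\<Sum>r<Suc d. G $$ (Suc k, r) * x r i)" if k: "k < d" for k i
    proof -
      have "(bs ! k) i = (\<Sum>r<Suc d. (bs ! k) (cs ! r) * x r i)"
        using bs_Y[OF k] Y(1) by (simp add: L del: sum.lessThan_Suc)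
      also have "\<dots> = (\<Sum>r<Suc d. G $$ (Suc k, r) * x r i)"
        using k by (intro sum.cong) (auto simp: G_def)
      finally show ?thesis .
    qed
    then have coords: "det (mat d d (\<lambda>(k, c). (bs ! k) (sorted_list_of_set J ! c)))
        = bordered (Suc d) x (\<lambda>r. det G * w r) J" for J
      by (intro minors_of_hyperplane[of G d w "(!) bs" x J] G Gw)
    have "p = cone_coords n d x (\<lambda>r. det G * w r)"
      unfolding p cone_coords_def by (rule ext) (simp only: coords)
    then show "p \<in> range (cone_coords n d x)" by blast
  qed
  show "range (cone_coords n d x) \<subseteq> plucker_cone n L"
  proof (intro image_subsetI)
    fix u :: "nat \<Rightarrow> 'k"
    show "cone_coords n d x u \<in> plucker_cone n L"
    proof (cases "\<exists>r0<Suc d. u r0 \<noteq> 0")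
      case False
      then have "cone_coords n d x u = 0"
        unfolding zero[symmetric] cone_coords_eq_sum by (intro sum.cong) auto
      then show ?thesis by (simp add: plucker_cone_def)
    next
      case True
      then obtain r0 where r0: "r0 < Suc d" "u r0 \<noteq> 0" by blast
      obtain G where G: "G \<in> carrier_mat (Suc d) (Suc d)" "det G = 1"
        and Gu: "\<And>i. i < Suc d \<Longrightarrow> (\<Sum>r<Suc d. G $$ (i, r) * u r) = (if i = 0 then 1 else 0)"
        using hyperplane_with_normal[of d r0 u, OF d r0] by blast
      define b where "b k i = (\<Sum>r<Suc d. G $$ (Suc k, r) * x r i)" for k i
      define bs where "bs = map b [0..<d]"
      have len: "length bs = d" by (simp add: bs_def)
      have nth: "bs ! k = b k" if "k < d" for k using that by (simp add: bs_def)
      have comb: "(\<Sum>k<length bs. fscale (a k) (bs ! k)) i = (\<Sum>k<d. a k * b k i)" for a i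
        unfolding sum_fscale_apply len using nth by (intro sum.cong) auto
      have b_pivot: "b k (cs ! s) = G $$ (Suc k, s)" if s: "s < Suc d" for k s
      proof -
        have "b k (cs ! s) = (\<Sum>r<Suc d. if r = s then G $$ (Suc k, r) else 0)"
          unfolding b_def using echelon s by (intro sum.cong) auto
        then show ?thesis using s by (simp del: sum.lessThan_Suc)
      qed
      define Y where "Y = range (\<lambda>a. \<Sum>k<length bs. fscale (a k) (bs ! k))"
      have indep: "\<forall>k<d. a k = 0" if zero: "(\<Sum>k<length bs. fscale (a k) (bs ! k)) = 0" for a
      proof -
        let ?a = "\<lambda>i. if i = 0 then 0 else a (i - 1)"
        have "(\<Sum>i<Suc d. ?a i * G $$ (i, s)) = 0" if s: "s < Suc d" for s
        proof -
          have "(\<Sum>i<Suc d. ?a i * G $$ (i, s)) = (\<Sum>k<d. a k * G $$ (Suc k, s))"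
            by (subst sum.lessThan_Suc_shift) simp
          also have "\<dots> = (\<Sum>k<length bs. fscale (a k) (bs ! k)) (cs ! s)"
            unfolding comb using b_pivot[OF s] by simp
          finally show ?thesis using zero by simp
        qed
        then have "\<forall>s<Suc d. (\<Sum>i<Suc d. ?a i * G $$ (i, s)) = 0" by (intro allI impI)
        moreover have "det G \<noteq> 0" using G(2) by simp
        ultimately have "\<forall>i<Suc d. ?a i = 0"
          by (rule row_kernel[OF G(1), THEN iffD1, THEN spec, THEN mp, rotated])
        then have "?a (Suc k) = 0" if "k < d" for k using that by blast
        then show ?thesis by simp
      qed
      then have basis: "ordered_basis Y bs"
        by (simp add: ordered_basis_iff Y_def len)
      have "Y \<in> L"
        unfolding L Gr_def
      proof (intro CollectI conjI ballI allI)
        show "fs.subspace Y" "fs.dim Y = d" using ordered_basis_dim[OF basis] len by auto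
        show "Y \<subseteq> coord_space {1..n}"
        proof
          fix v assume "v \<in> Y"
          then obtain a where "v = (\<Sum>k<length bs. fscale (a k) (bs ! k))" by (auto simp: Y_def)
          then have "v i = (\<Sum>k<d. a k * b k i)" for i using comb by simp
          moreover have "b k i = 0" if "i \<notin> {1..n}" for k i
            unfolding b_def using supp that by (intro sum.neutral) auto
          ultimately show "v \<in> coord_space {1..n}" by (auto simp: coord_space_def)
        qed
        fix v i assume "v \<in> Y"
        then obtain a where "v = (\<Sum>k<length bs. fscale (a k) (bs ! k))" by (auto simp: Y_def)
        then have v: "v i = (\<Sum>k<d. a k * b k i)" for i using comb by simp
        have "(\<Sum>r<Suc d. v (cs ! r) * x r i)
            = (\<Sum>r<Suc d. \<Sum>k<d. a k * (G $$ (Suc k, r) * x r i))"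
          unfolding v sum_distrib_right
          by (intro sum.cong refl) (simp add: b_pivot mult.assoc)
        also have "\<dots> = v i"
          unfolding v b_def sum_distrib_left by (rule sum.swap)
        finally show "v i = (\<Sum>r<Suc d. v (cs ! r) * x r i)" by simp
      qed
      moreover have "plucker_coords (<) {1..n} Y (cone_coords n d x u)"
      proof (rule plucker_coords_hyperplane[OF basis len])
        fix J :: "nat set"
        show "det (mat d d (\<lambda>(k, c). (bs ! k) (sorted_list_of_set J ! c)))
            = bordered (Suc d) x u J"
          using minors_of_hyperplane[OF G(1) Gu, of "(!) bs" x J] nth G(2) by (simp add: b_def)
      qed
      ultimately show ?thesis by (auto simp: plucker_cone_def)
    qed
  qed
qed

text \<open>
  Any basis of the cone arises from the cofactors by an invertible matrix, whose determinant is the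
  common factor \<open>g\<close>.
\<close>
lemma plucker_coords_cone:
  assumes "plucker_coords lt (nsets {1..n} d) (range (cone_coords n d x)) p"
  obtains g where "g \<noteq> 0"
    "\<And>Js. length Js = Suc d \<Longrightarrow> set Js \<subseteq> nsets {1..n} d \<Longrightarrow> sorted_wrt lt Js \<Longrightarrow>
       p (set Js) = g * minor (Suc d) (border_cofactor (Suc d) x) Js"
proof -
  let ?U = "range (cone_coords n d x)"
  obtain bs where bs: "ordered_basis ?U bs"
    and p: "\<And>xs. sorted_wrt lt xs \<Longrightarrow> set xs \<subseteq> nsets {1..n} d \<Longrightarrow> length xs = length bs \<Longrightarrow>
           p (set xs) = det (mat (length bs) (length bs) (\<lambda>(r, c). (bs ! r) (xs ! c)))"
    using assms unfolding plucker_coords_def by blast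
  have len: "length bs = Suc d"
    using ordered_basis_dim(2)[OF bs] ordered_basis_dim(2)[OF ordered_basis_cone] by simp
  have "bs ! r \<in> ?U" if "r < Suc d" for r
    using bs that len unfolding ordered_basis_def by (metis fs.span_base nth_mem)
  then have "\<exists>u. bs ! r = cone_coords n d x u" if "r < Suc d" for r
    using that by blast
  then obtain g where g: "\<And>r. r < Suc d \<Longrightarrow> bs ! r = cone_coords n d x (g r)" by metis
  let ?G = "mat (Suc d) (Suc d) (\<lambda>(r, s). g r s)"
  have "det ?G \<noteq> 0"
    unfolding row_kernel[OF mat_carrier]
  proof (intro allI impI)
    fix a r assume a: "\<forall>s<Suc d. (\<Sum>r<Suc d. a r * ?G $$ (r, s)) = 0" and r: "r < Suc d"
    have "(\<Sum>r<length bs. fscale (a r) (bs ! r)) = 0"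
    proof
      fix J
      have "(\<Sum>r<length bs. fscale (a r) (bs ! r)) J
          = (\<Sum>r<Suc d. \<Sum>s<Suc d. a r * (g r s * cone_basis n d x s J))"
        unfolding sum_fscale_apply len sum_distrib_left[symmetric]
        using g by (intro sum.cong) (auto simp: cone_coords_eq_sum sum_fscale_apply
            simp del: sum.lessThan_Suc)
      also have "\<dots> = (\<Sum>s<Suc d. (\<Sum>r<Suc d. a r * ?G $$ (r, s)) * cone_basis n d x s J)"
        unfolding sum_distrib_right by (subst sum.swap) (intro sum.cong refl, simp)
      also have "\<dots> = 0" using a by (intro sum.neutral) auto
      finally show "(\<Sum>r<length bs. fscale (a r) (bs ! r)) J = 0 J" by simp
    qed
    then have "\<forall>r<length bs. a r = 0"
      by (rule bs[unfolded ordered_basis_iff, THEN conjunct2, THEN spec, THEN mp])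
    then show "a r = 0" using r len by simp
  qed
  moreover have "p (set Js) = det ?G * minor (Suc d) (border_cofactor (Suc d) x) Js"
    if Js: "length Js = Suc d" "set Js \<subseteq> nsets {1..n} d" "sorted_wrt lt Js" for Js
  proof -
    have "mat (Suc d) (Suc d) (\<lambda>(r, c). (bs ! r) (Js ! c))
        = ?G * mat (Suc d) (Suc d) (\<lambda>(r, c). border_cofactor (Suc d) x r (Js ! c))"
    proof (intro eq_matI)
      fix r c assume "r < dim_row (?G * mat (Suc d) (Suc d) (\<lambda>(r, c). border_cofactor (Suc d) x r (Js ! c)))"
        "c < dim_col (?G * mat (Suc d) (Suc d) (\<lambda>(r, c). border_cofactor (Suc d) x r (Js ! c)))"
      then have rc: "r < Suc d" "c < Suc d" by auto
      then have "Js ! c \<in> nsets {1..n} d" using Js by auto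
      then have "cone_coords n d x (g r) (Js ! c)
          = (\<Sum>s<Suc d. g r s * border_cofactor (Suc d) x s (Js ! c))"
        by (simp only: cone_coords_def bordered_expand[OF zero_less_Suc] if_True)
      then show "mat (Suc d) (Suc d) (\<lambda>(r, c). (bs ! r) (Js ! c)) $$ (r, c)
        = (?G * mat (Suc d) (Suc d) (\<lambda>(r, c). border_cofactor (Suc d) x r (Js ! c))) $$ (r, c)"
        using rc g[OF rc(1)]
        by (simp add: scalar_prod_def atLeast0LessThan del: sum.lessThan_Suc)
    qed simp_all
    then show ?thesis
      using p[of Js] Js len by (simp add: minor_def det_mult[of _ "Suc d"])
  qed
  ultimately show thesis using that by blast
qed

end

section \<open>The coordinates of the linear space\<close>

lemma lex_less_irrefl: "\<not> lex_less I I"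
  unfolding lex_less_def by (rule lexord_irreflexive) simp

lemma sorted_wrt_lex_less_distinct: "sorted_wrt lex_less Js \<Longrightarrow> distinct Js"
  by (induction Js) (auto simp: lex_less_irrefl)

theorem theorem2:
  fixes d n :: nat
    and X :: "(nat \<Rightarrow> 'k::alg_closed_field) set"
    and q :: "nat set \<Rightarrow> 'k"
    and S :: "nat set"
  assumes "1 \<le> d" and "d \<le> n - 1"
    and "fs.subspace X" and "X \<subseteq> coord_space {1..n}" and "fs.dim X = d + 1"
    and "plucker_coords (<) {1..n} X q"
    and "S \<subseteq> {1..n}"
    and "\<exists>C \<in> nsets {1..n} (d + 1). S \<subseteq> C \<and> q C \<noteq> 0"
  shows "fs.subspace (plucker_cone n (L_space d n S X)) \<and>
    fs.dim (plucker_cone n (L_space d n S X)) = d + 1 \<and>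
    (\<forall>p. plucker_coords lex_less (nsets {1..n} d) (plucker_cone n (L_space d n S X)) p \<longrightarrow>
      (\<exists>c. c \<noteq> 0 \<and>
        (\<forall>Js hs i\<^sub>0 I\<^sub>0.
          length Js = d + 1 \<and> set Js \<subseteq> nsets {1..n} d \<and> sorted_wrt lex_less Js \<and>
          hs = map (\<lambda>J. {1..n} - J) Js \<and>
          i\<^sub>0 < d + 1 \<and> I\<^sub>0 \<subseteq> hs ! i\<^sub>0 \<and> card I\<^sub>0 = n - d - 1 \<longrightarrow>
          p (set Js) = c *
            (if \<forall>v\<in>S. leaf hs v
             then (\<Sum>ts | orientation hs ts \<and> roots hs ts = I\<^sub>0.
                     of_int (root_sign I\<^sub>0 hs ts) *
                     (\<Prod>i\<in>{..<d + 1} - {i\<^sub>0}. q ({1..n} - sources hs ts i)))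
             else 0))))"
proof -
  obtain C where C: "C \<in> nsets {1..n} (Suc d)" "S \<subseteq> C" "q C \<noteq> 0"
    using assms(8) by auto
  define cs where "cs = sorted_list_of_set C"
  have cs: "sorted cs" "distinct cs" "length cs = Suc d" "set cs \<subseteq> {1..n}" "S \<subseteq> set cs"
    using C by (auto simp: cs_def nsets_def)
  obtain y where y:
    "\<And>r k. r < Suc d \<Longrightarrow> k < Suc d \<Longrightarrow> y r (cs ! k) = (if r = k then 1 else 0)"
    "\<And>r. r < Suc d \<Longrightarrow> y r \<in> X"
    "\<And>v i. v \<in> X \<Longrightarrow> v i = (\<Sum>r<Suc d. v (cs ! r) * y r i)"
    "\<And>I. I \<in> nsets {1..n} (Suc d) \<Longrightarrow> sorted_minor (Suc d) y I = inverse (q C) * q I"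
    using echelon_basis[OF assms(6) _ C(1,3)] assms(5) unfolding cs_def Suc_eq_plus1 by blast
  define x where "x = adapted_basis y S cs"
  have echelon: "x r (cs ! k) = (if r = k then 1 else 0)" if "r < Suc d" "k < Suc d" for r k
    unfolding x_def using that cs y(1) by (intro adapted_basis_echelon[of cs "Suc d" y]) auto
  have supp: "x r i = 0" if "r < Suc d" "i \<notin> {1..n}" for r i
  proof -
    have "y r i = 0" using y(2)[OF that(1)] that(2) assms(4) by (auto simp: coord_space_def)
    moreover have "cs ! r \<in> {1..n}" using subsetD[OF cs(4) nth_mem] that(1) cs(3) by simp
    ultimately show ?thesis using that(2) by (auto simp: x_def adapted_basis_def)
  qed
  have minor_x: "sorted_minor (Suc d) x I = (if S \<subseteq> I then inverse (q C) * q I else 0)"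
    if "I \<in> nsets {1..n} (Suc d)" for I
    unfolding x_def
    using sorted_minor_adapted[OF cs(2,3,5) y(1), of I] y(4)[OF that] that by (simp add: nsets_def)
  have "L_space d n S X = {Y \<in> Gr d n. \<forall>v\<in>Y. coord_pr S v \<in> X}"
    by (auto simp: L_space_def)
  also have "\<dots> = {Y \<in> Gr d n. \<forall>v\<in>Y. \<forall>i. v i = (\<Sum>r<Suc d. v (cs ! r) * x r i)}"
    unfolding x_def by (simp only: coord_pr_mem_iff[OF assms(3) cs(2,3,5) y(1-3)])
  finally have cone: "plucker_cone n (L_space d n S X) = range (cone_coords n d x)"
    using cone_eq[OF assms(1) cs(1-4) echelon supp] by simp
  have basis: "ordered_basis (range (cone_coords n d x)) (map (cone_basis n d x) [0..<Suc d])"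
    by (rule ordered_basis_cone[OF assms(1) cs(1-4) echelon supp])
  show ?thesis
    unfolding cone
  proof (intro conjI allI impI)
    show "fs.subspace (range (cone_coords n d x))" by (rule ordered_basis_dim(1)[OF basis])
    show "fs.dim (range (cone_coords n d x)) = d + 1" using ordered_basis_dim(2)[OF basis] by simp
    fix p assume "plucker_coords lex_less (nsets {1..n} d) (range (cone_coords n d x)) p"
    then obtain g where g: "g \<noteq> 0" and p:
      "\<And>Js. length Js = Suc d \<Longrightarrow> set Js \<subseteq> nsets {1..n} d \<Longrightarrow> sorted_wrt lex_less Js \<Longrightarrow>
         p (set Js) = g * minor (Suc d) (border_cofactor (Suc d) x) Js"
      using plucker_coords_cone[OF assms(1) cs(1-4) echelon supp] by blast
    \<comment> \<open>The change of basis of the cone, the sign discrepancy, and a factor \<open>1 / q\<^sub>C\<close> for each of the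
      \<open>d\<close> minors in a summand.\<close>
    let ?c = "g * (of_int (ambient_sign n d) * inverse (q C) ^ d)"
    have "(of_int (ambient_sign n d) :: 'k) \<noteq> 0"
      by (simp add: ambient_sign_def)
    then have "?c \<noteq> 0" using g C(3) by simp
    moreover have "p (set Js) = ?c *
            (if \<forall>v\<in>S. leaf hs v
             then (\<Sum>ts | orientation hs ts \<and> roots hs ts = I0.
                     of_int (root_sign I0 hs ts) *
                     (\<Prod>i\<in>{..<d + 1} - {i0}. q ({1..n} - sources hs ts i)))
             else 0)"
      if "length Js = d + 1 \<and> set Js \<subseteq> nsets {1..n} d \<and> sorted_wrt lex_less Js \<and>
          hs = map (\<lambda>J. {1..n} - J) Js \<and>
          i0 < d + 1 \<and> I0 \<subseteq> hs ! i0 \<and> card I0 = n - d - 1" for Js hs i0 I0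
    proof -
      have d: "d < n" using assms(1,2) by simp
      have Js: "length Js = Suc d" "set Js \<subseteq> nsets {1..n} d" and sorted: "sorted_wrt lex_less Js"
        and hs: "hs = map (\<lambda>J. {1..n} - J) Js"
        and i0: "i0 < Suc d" and I0: "I0 \<subseteq> hs ! i0" "card I0 = n - d - 1"
        using that by auto
      note hyp = d Js hs i0 I0
      have "distinct Js" using sorted by (rule sorted_wrt_lex_less_distinct)
      have "minor (Suc d) (border_cofactor (Suc d) x) Js = target_list_sum (Suc d) x Js i0 ({1..n} - I0)"
      proof (rule det_border_cofactor)
        show "finite (Js ! i) \<and> Suc (card (Js ! i)) = Suc d" if "i < Suc d" for i
          using Js_nth[OF hyp that] by simp
        show "card ({1..n} - I0) = Suc d" by (rule card_nonroots[OF hyp])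
        show "Js ! i0 \<subseteq> {1..n} - I0" using Js_nth[OF hyp i0] hs_nth[OF hyp i0] I0 by auto
      qed (use i0 in auto)
      also have "\<dots> = of_int (ambient_sign n d) * inverse (q C) ^ d *
            (if \<forall>v\<in>S. leaf hs v
             then (\<Sum>ts | orientation hs ts \<and> roots hs ts = I0.
                     of_int (root_sign I0 hs ts) *
                     (\<Prod>i\<in>{..<Suc d} - {i0}. q ({1..n} - sources hs ts i)))
             else 0)"
        by (rule target_list_sum_eq[OF hyp \<open>distinct Js\<close> assms(7) minor_x])
      finally show ?thesis
        using p[OF Js sorted] by (simp only: mult.assoc Suc_eq_plus1)
    qed
    ultimately show "\<exists>c. c \<noteq> 0 \<and>
        (\<forall>Js hs i\<^sub>0 I\<^sub>0.
          length Js = d + 1 \<and> set Js \<subseteq> nsets {1..n} d \<and> sorted_wrt lex_less Js \<and>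
          hs = map (\<lambda>J. {1..n} - J) Js \<and>
          i\<^sub>0 < d + 1 \<and> I\<^sub>0 \<subseteq> hs ! i\<^sub>0 \<and> card I\<^sub>0 = n - d - 1 \<longrightarrow>
          p (set Js) = c *
            (if \<forall>v\<in>S. leaf hs v
             then (\<Sum>ts | orientation hs ts \<and> roots hs ts = I\<^sub>0.
                     of_int (root_sign I\<^sub>0 hs ts) *
                     (\<Prod>i\<in>{..<d + 1} - {i\<^sub>0}. q ({1..n} - sources hs ts i)))
             else 0))"
      by (intro exI[of _ ?c] conjI allI impI)
  qed
qed

end
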